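(* Assume the separable-domain, separable-operator, local differential-channel and separable-architecture setting described in the context, on the tensor-product collocation grid. Then the following hold. (i) For $s=1,\dots,d$ the collocated Jacobian blocks factorize as $\mathrm J_s=\Psi_s^{\mathrm{ch}}\mathsf C_s^{\mathrm{ch}}$. The full residual Jacobian $\mathrm J_\rho=[\mathrm J_1\ \cdots\ \mathrm J_d]\in\mathbb R^{N_{\mathcal D}\times P}$ satisfies $\mathrm J_\rho=\Psi^{\mathrm{ch}}\mathsf C^{\mathrm{ch}}$ with $\Psi^{\mathrm{ch}}:=[\Psi_1^{\mathrm{ch}}\ \cdots\ \Psi_d^{\mathrm{ch}}]\in\mathbb R^{N_{\mathcal D}\times N_{\mathrm{eff}}^{\mathrm{ch}}}$ and the block-diagonal matrix $\mathsf C^{\mathrm{ch}}:=\operatorname{diag}(\mathsf C_1^{\mathrm{ch}},\dots,\mathsf C_d^{\mathrm{ch}})\in\mathbb R^{N_{\mathrm{eff}}^{\mathrm{ch}}\times P}$, where $$N_{\mathrm{eff}}^{\mathrm{ch}}:=\sum_{s=1}^dN_s^{\mathrm{ch}}=\sum_{s=1}^dL_sn_sk_s .$$ (ii) Let $\Upsilon^{\mathrm{ch}}:=\frac1{N_{\mathcal D}}(\Psi^{\mathrm{ch}})^\top\Psi^{\mathrm{ch}}=[\Upsilon^{\mathrm{ch}}_{st}]_{s,t=1}^d$ with $\Upsilon_{st}^{\mathrm{ch}}:=\frac1{N_{\mathcal D}}(\Psi_s^{\mathrm{ch}})^\top\Psi_t^{\mathrm{ch}}$, each block being composed of the channel-indexed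 blocks $\Upsilon_{st}^{\mathrm{ch},(\ell,\ell')}:=\frac1{N_{\mathcal D}}(\Psi_{s,\ell}^{\mathrm{ch}})^\top\Psi_{t,\ell'}^{\mathrm{ch}}\in\mathbb R^{n_sk_s\times n_tk_t}$, $\ell\in\Lambda_s$, $\ell'\in\Lambda_t$. Then the discrete Gauss--Newton Gramian $\widehat{\mathrm G}=\frac1{N_{\mathcal D}}\mathrm J_\rho^\top\mathrm J_\rho$, with blocks $\widehat{\mathrm G}_{st}=\frac1{N_{\mathcal D}}\mathrm J_s^\top\mathrm J_t$, satisfies $$\widehat{\mathrm G}=(\mathsf C^{\mathrm{ch}})^\top\Upsilon^{\mathrm{ch}}\mathsf C^{\mathrm{ch}},\qquad \widehat{\mathrm G}_{st}=(\mathsf C_s^{\mathrm{ch}})^\top\Upsilon_{st}^{\mathrm{ch}}\mathsf C_t^{\mathrm{ch}},$$ and in particular $\operatorname{rank}(\widehat{\mathrm G})=\operatorname{rank}(\mathrm J_\rho)\le\min\{N_{\mathcal D},N_{\mathrm{eff}}^{\mathrm{ch}},P\}$. (iii) Let $\rho_{\mathrm c}^{\mathrm{ch}}:=\frac1{N_{\mathcal D}}(\Psi^{\mathrm{ch}})^\top\rho(\theta)$, the vertical stack of $\rho_{\mathrm c,s}^{\mathrm{ch}}:=\frac1{N_{\mathcal D}}(\Psi_s^{\mathrm{ch}})^\top\rho(\theta)\in\mathbb R^{N_s^{\mathrm{ch}}}$, each of which is the vertical stack over $\ell\in\Lambda_s$ of $\rho_{\mathrm c,s}^{\mathrm{ch},(\ell)}:=\frac1{N_{\mathcal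 D}}(\Psi_{s,\ell}^{\mathrm{ch}})^\top\rho(\theta)\in\mathbb R^{n_sk_s}$. Then $$\nabla\widehat{\mathcal L}(\theta)=(\mathsf C^{\mathrm{ch}})^\top\rho_{\mathrm c}^{\mathrm{ch}},\qquad \nabla_{\theta^s}\widehat{\mathcal L}(\theta)=(\mathsf C_s^{\mathrm{ch}})^\top\rho_{\mathrm c,s}^{\mathrm{ch}},\quad s=1,\dots,d.$$
   Context: Domain: $d=d_x+d_\xi$; $\Omega=\mathcal D_1\times\cdots\times\mathcal D_{d_x}$, $\Xi=\mathcal D_{d_x+1}\times\cdots\times\mathcal D_d$, $\mathcal D=\Omega\times\Xi$, where $\mathcal D_m=(z_m^-,z_m^+)\subset\mathbb R$ are bounded open intervals. $L^2(\mathcal D)$ is identified with $\bigotimes_m L^2(\mathcal D_m)$; $v_1\otimes\cdots\otimes v_d$ is the function $\prod_m v_m(z_m)$. Operator: $V$ is a Hilbert space of functions on $\Omega$ with bounded trace $V\to L^2(\partial\Omega)$, $U=L^2(\Xi;V)$, $\mathcal A:U\to L^2(\mathcal D)$ bounded linear. There are Hilbert spaces $H_m\hookrightarrow L^2(\mathcal D_m)$ such that $H=H_1\otimes\cdots\otimes H_d$ (Hilbert tensor product) satisfies $\|v_1\otimes\cdots\otimes v_d\|_H=\prod_m\|v_m\|_{H_m}$, is continuously and densely embedded in $U$, and $\mathcal A|_H=\sum_{\beta=1}^{R_{\mathcal A}}\mathcal A_1^{(\beta)}\otimes\cdots\otimes\mathcal A_d^{(\beta)}$ with bounded linear $\mathcal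 A_m^{(\beta)}:H_m\to L^2(\mathcal D_m)$. Local differential channels: for every $s$ there are a finite index set $\Lambda_s$ with $L_s:=|\Lambda_s|$, bounded linear differential operators $\mathcal D_s^\ell:H_s\to L^2(\mathcal D_s)$ ($\ell\in\Lambda_s$) and coefficients $b_{s,\ell}^{(\beta)}\in C(\overline{\mathcal D_s})$ with $\mathcal A_s^{(\beta)}v=\sum_{\ell\in\Lambda_s}b_{s,\ell}^{(\beta)}\mathcal D_s^\ell v$ for all $v\in H_s$, $\beta=1,\dots,R_{\mathcal A}$. Architecture: $\theta=(\theta^1,\dots,\theta^d)$, $\theta^m\in\mathbb R^{P_m}$, $P=\sum_mP_m$; differentiable maps $\mathbb R^{P_m}\to H_m^{k_m}$, $\theta^m\mapsto(w_m^1,\dots,w_m^{k_m})$; a fixed array $c\in\mathbb R^{k_1\times\cdots\times k_d}$; $u_\theta=\sum_{a_1,\dots,a_d}c_{a_1\ldots a_d}\,w_1^{a_1}\otimes\cdots\otimes w_d^{a_d}\in H$. Index convention: $\overline{i_1\ldots i_k}=i_k+(i_{k-1}-1)n_k+\cdots+(i_1-1)n_2\cdots n_k$ is the lexicographic position of $(i_1,\dots,i_k)$ (leftmost index slowest). Collocation: $\mathcal X_m=\{z_{m,1},\dots,z_{m,n_m}\}\subset\mathcal D_m$, $N_{\mathcal D}=\prod_mn_m$, and for $i=\overline{i_1\ldots i_d}$ put $z_i=(z_{1,i_1},\dots,z_{d,i_d})$. The functions $\mathcal D_m^\ell w_m^{a}$ and $\mathcal D_m^\ell\partial_{\theta^m_j}w_m^{a}$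 are assumed to have continuous representatives on $\overline{\mathcal D_m}$ and $f\in L^2(\mathcal D)$ admits pointwise evaluation. $\mathrm J_s\in\mathbb R^{N_{\mathcal D}\times P_s}$, $\mathrm J_s(i,j)=(\mathcal A\partial_{\theta^s_j}u_\theta)(z_i)$; $\rho(\theta)\in\mathbb R^{N_{\mathcal D}}$, $\rho(\theta)_i=(\mathcal Au_\theta-f)(z_i)$; $\widehat{\mathcal L}(\theta)=\frac1{2N_{\mathcal D}}\|\rho(\theta)\|_2^2$ with discrete gradient $\nabla\widehat{\mathcal L}(\theta)=\frac1{N_{\mathcal D}}\mathrm J_\rho^\top\rho(\theta)$ and blocks $\nabla_{\theta^s}\widehat{\mathcal L}(\theta)=\frac1{N_{\mathcal D}}\mathrm J_s^\top\rho(\theta)$. Factors: $i_{-s}$, $a_{-s}$ denote the multi-indices with the $s$-th entry removed, $N_{-s}=\prod_{m\ne s}n_m$, and $$\mathsf E_s^{(\beta)}(\overline{i_{-s}},a_s)=\sum_{a_{-s}}c_{a_1\ldots a_d}\prod_{m\ne s}(\mathcal A_m^{(\beta)}w_m^{a_m})(z_{m,i_m}),\qquad\mathsf E_s^{(\beta)}\in\mathbb R^{N_{-s}\times k_s}.$$ For $\ell\in\Lambda_s$ set $$\mathsf H_{s,\ell}(\overline{i_sa_s},j)=(\mathcal D_s^\ell\partial_{\theta^s_j}w_s^{a_s})(z_{s,i_s}),\qquad \mathsf H_{s,\ell}\in\mathbb R^{n_sk_s\times P_s},$$ $$\Psi_{s,\ell}^{\mathrm{ch}}(i,\overline{j_sa_s})=\delta_{i_sj_s}\sum_{\beta=1}^{R_{\mathcal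 A}}b_{s,\ell}^{(\beta)}(z_{s,j_s})\,\mathsf E_s^{(\beta)}(\overline{i_{-s}},a_s),\qquad \Psi_{s,\ell}^{\mathrm{ch}}\in\mathbb R^{N_{\mathcal D}\times n_sk_s}.$$ With $\Lambda_s=\{\ell_1,\dots,\ell_{L_s}\}$ in a fixed order, $\Psi_s^{\mathrm{ch}}=[\Psi_{s,\ell_1}^{\mathrm{ch}}\ \cdots\ \Psi_{s,\ell_{L_s}}^{\mathrm{ch}}]\in\mathbb R^{N_{\mathcal D}\times N_s^{\mathrm{ch}}}$ and $\mathsf C_s^{\mathrm{ch}}\in\mathbb R^{N_s^{\mathrm{ch}}\times P_s}$ is the vertical stack of $\mathsf H_{s,\ell_1},\dots,\mathsf H_{s,\ell_{L_s}}$, with $N_s^{\mathrm{ch}}:=L_sn_sk_s$. *)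

theory Defs
  imports
    "HOL-Analysis.Analysis"
    "Jordan_Normal_Form.DL_Rank"
begin

no_notation vec_nth (infixl \<open>$\<close> 90)

section \<open>Multi-indices\<close>

text \<open>All indices are 0-based: the paper's $1 \le i_m \le n_m$ becomes \<open>i < n\<close>.  A multi-index is
  the list of its entries.  Its lexicographic position (leftmost entry slowest) is
  $\sum_m i_m \prod_{m' > m} n_{m'}$, the 0-based form of $\overline{i_1 \ldots i_k}$.\<close>

definition idx_set :: "nat list \<Rightarrow> nat list set" where
  "idx_set ns = {is. list_all2 (<) is ns}"

fun lex_pos :: "nat list \<Rightarrow> nat list \<Rightarrow> nat" where
  "lex_pos (n # ns) (i # is) = i * prod_list ns + lex_pos ns is"
| "lex_pos _ _ = 0"

text \<open>Inverse of \<^const>\<open>lex_pos\<close> on positions below the product of the sizes.\<close>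

fun multi_idx :: "nat list \<Rightarrow> nat \<Rightarrow> nat list" where
  "multi_idx [] p = []"
| "multi_idx (n # ns) p = (p div prod_list ns) # multi_idx ns (p mod prod_list ns)"

definition remove_nth :: "nat \<Rightarrow> 'a list \<Rightarrow> 'a list" where
  "remove_nth s xs = take s xs @ drop (Suc s) xs"

lemma lex_pos_less: "is \<in> idx_set ns \<Longrightarrow> lex_pos ns is < prod_list ns"
proof (induction ns arbitrary: "is")
  case (Cons n ns)
  from Cons.prems obtain i js where ij: "is = i # js" "i < n" "js \<in> idx_set ns"
    by (auto simp: idx_set_def list_all2_Cons2)
  have "i * prod_list ns + lex_pos ns js < Suc i * prod_list ns"
    using Cons.IH[OF ij(3)] by simp
  also have "\<dots> \<le> n * prod_list ns"
    using ij(2) by (intro mult_le_mono) auto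
  finally show ?case by (simp add: ij(1))
qed (auto simp: idx_set_def)

lemma multi_idx_lex_pos: "is \<in> idx_set ns \<Longrightarrow> multi_idx ns (lex_pos ns is) = is"
proof (induction ns arbitrary: "is")
  case (Cons n ns)
  from Cons.prems obtain i js where ij: "is = i # js" "i < n" "js \<in> idx_set ns"
    by (auto simp: idx_set_def list_all2_Cons2)
  have "(i * prod_list ns + lex_pos ns js) div prod_list ns = i"
    using lex_pos_less[OF ij(3)] by (intro div_nat_eqI) auto
  then show ?case using Cons.IH[OF ij(3)] lex_pos_less[OF ij(3)] by (simp add: ij(1))
qed (auto simp: idx_set_def)

lemma multi_idx_in_idx_set: "p < prod_list ns \<Longrightarrow> multi_idx ns p \<in> idx_set ns"
proof (induction ns arbitrary: p)
  case (Cons n ns)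
  have pos: "0 < prod_list ns" using Cons.prems by (cases "prod_list ns") auto
  have "p div prod_list ns < n" using Cons.prems by (simp add: less_mult_imp_div_less)
  moreover have "multi_idx ns (p mod prod_list ns) \<in> idx_set ns"
    using Cons.IH pos by simp
  ultimately show ?case by (simp add: idx_set_def)
qed (auto simp: idx_set_def)

lemma lex_pos_multi_idx: "p < prod_list ns \<Longrightarrow> lex_pos ns (multi_idx ns p) = p"
proof (induction ns arbitrary: p)
  case (Cons n ns)
  have "0 < prod_list ns" using Cons.prems by (cases "prod_list ns") auto
  then show ?case using Cons.IH by simp
qed auto


section \<open>Block matrices\<close>

definition append_cols :: "'a::zero mat \<Rightarrow> 'a mat \<Rightarrow> 'a mat" where
  "append_cols A B = four_block_mat A B (0\<^sub>m 0 (dim_col A)) (0\<^sub>m 0 (dim_col B))"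

definition hcat :: "nat \<Rightarrow> 'a::zero mat list \<Rightarrow> 'a mat" where
  "hcat nr As = foldr append_cols As (0\<^sub>m nr 0)"

definition vcat :: "nat \<Rightarrow> 'a::zero mat list \<Rightarrow> 'a mat" where
  "vcat nc As = foldr append_rows As (0\<^sub>m 0 nc)"

definition vstack :: "'a Matrix.vec list \<Rightarrow> 'a Matrix.vec" where
  "vstack vs = foldr append_vec vs vNil"

abbreviation mat_rank :: "'a::field mat \<Rightarrow> nat" where
  "mat_rank A \<equiv> vec_space.rank (dim_row A) A"


section \<open>Square-integrable functions and point values\<close>

text \<open>Elements of $L^2$ spaces are represented by functions, and identities between them are
  stated almost everywhere.  When the values lie in a Hilbert space this is the Bochner space;
  since the type of values is second countable, Borel measurability is strong measurability.\<close>

definition L2_fun ::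
    "'x measure \<Rightarrow> ('x \<Rightarrow> 'b::{real_normed_vector, second_countable_topology}) set" where
  "L2_fun M = {f \<in> borel_measurable M. integrable M (\<lambda>x. (norm (f x))\<^sup>2)}"

definition L2_nrm ::
    "'x measure \<Rightarrow> ('x \<Rightarrow> 'b::{real_normed_vector, second_countable_topology}) \<Rightarrow> real" where
  "L2_nrm M f = sqrt (\<integral>x. (norm (f x))\<^sup>2 \<partial>M)"

definition linear_ae ::
    "'e::real_vector set \<Rightarrow> 'x measure \<Rightarrow> ('e \<Rightarrow> 'x \<Rightarrow> 'b::real_vector) \<Rightarrow> bool" where
  "linear_ae E M T \<longleftrightarrow>
     (\<forall>v\<in>E. \<forall>w\<in>E. AE x in M. T (v + w) x = T v x + T w x) \<and>
     (\<forall>r. \<forall>v\<in>E. AE x in M. T (r *\<^sub>R v) x = r *\<^sub>R T v x)"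

definition bounded_linear_L2 ::
    "'e::real_normed_vector set \<Rightarrow> 'x measure \<Rightarrow>
     ('e \<Rightarrow> 'x \<Rightarrow> 'b::{real_normed_vector, second_countable_topology}) \<Rightarrow> bool" where
  "bounded_linear_L2 E M T \<longleftrightarrow>
     (\<forall>v\<in>E. T v \<in> L2_fun M) \<and> linear_ae E M T \<and>
     (\<exists>C. \<forall>v\<in>E. L2_nrm M (T v) \<le> C * norm v)"

definition injective_ae ::
    "'e::zero set \<Rightarrow> 'x measure \<Rightarrow> ('e \<Rightarrow> 'x \<Rightarrow> 'b::zero) \<Rightarrow> bool" where
  "injective_ae E M T \<longleftrightarrow> (\<forall>v\<in>E. (AE x in M. T v x = 0) \<longrightarrow> v = 0)"

definition cont_rep ::
    "'x::topological_space measure \<Rightarrow> 'x set \<Rightarrow> ('x \<Rightarrow> real) \<Rightarrow> ('x \<Rightarrow> real) \<Rightarrow> bool" where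
  "cont_rep M K f h \<longleftrightarrow> continuous_on K h \<and> (AE x in M. h x = f x)"

text \<open>Evaluation at a point of a class of functions: the value of its continuous representative.\<close>

definition pt_val ::
    "'x::topological_space measure \<Rightarrow> 'x set \<Rightarrow> ('x \<Rightarrow> real) \<Rightarrow> 'x \<Rightarrow> real" where
  "pt_val M K f x = (THE y. \<exists>h. cont_rep M K f h \<and> h x = y)"


section \<open>Maps on parameter blocks\<close>

text \<open>Frechet differentiability of a map on $\mathbb R^P$ with values in a normed space.\<close>

definition differentiable_at_vec ::
    "nat \<Rightarrow> (real Matrix.vec \<Rightarrow> 'e::real_normed_vector) \<Rightarrow> real Matrix.vec \<Rightarrow> bool" where
  "differentiable_at_vec P F \<theta> \<longleftrightarrow>
     (\<exists>g :: nat \<Rightarrow> 'e. \<forall>\<epsilon>>0. \<exists>\<delta>>0. \<forall>h\<in>carrier_vec P. L2_set (vec_index h) {..<P} < \<delta> \<longrightarrow>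
        norm (F (\<theta> + h) - F \<theta> - (\<Sum>j<P. vec_index h j *\<^sub>R g j))
          \<le> \<epsilon> * L2_set (vec_index h) {..<P})"

definition partial ::
    "nat \<Rightarrow> (real Matrix.vec \<Rightarrow> 'e::real_normed_vector) \<Rightarrow> real Matrix.vec \<Rightarrow> nat \<Rightarrow> 'e" where
  "partial P F \<theta> j = vector_derivative (\<lambda>t. F (\<theta> + t \<cdot>\<^sub>v unit_vec P j)) (at 0)"


section \<open>The separable setting\<close>

text \<open>The coordinates are \<open>m < dx + dxi\<close>, those of $\Omega$ being \<open>m < dx\<close>.
  The Hilbert spaces $H_m$ are closed subspaces \<open>Hsp m\<close> of one Hilbert space \<open>'h\<close> (their
  orthogonal sum, for instance), $H$ is the type \<open>'g\<close>, $V$ the type \<open>'v\<close>.  The inclusions of these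
  spaces into spaces of functions are explicit: \<open>Hfun\<close>, \<open>Uemb\<close> ($H \to U = L^2(\Xi; V)$), \<open>Vfun\<close>.

  \<open>ten v\<close> is $v_1 \otimes \cdots \otimes v_d \in H$, \<open>Aop m \<beta>\<close> is $\mathcal A_m^{(\beta)}$,
  \<open>Lam s\<close> lists $\Lambda_s$ in its fixed order, \<open>Dop s l\<close> is $\mathcal D_s^\ell$ and
  \<open>bco s l \<beta>\<close> is $b_{s,\ell}^{(\beta)}$.  \<open>net m a\<close> is $\theta^m \mapsto w_m^a$.\<close>

record ('h, 'g, 'v, 'l) setting =
  dx :: nat
  dxi :: nat
  zlo :: "nat \<Rightarrow> real"
  zhi :: "nat \<Rightarrow> real"
  Vfun :: "'v \<Rightarrow> (nat \<Rightarrow> real) \<Rightarrow> real"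
  trace_op :: "'v \<Rightarrow> (nat \<Rightarrow> real) \<Rightarrow> real"
  Hsp :: "nat \<Rightarrow> 'h set"
  Hfun :: "nat \<Rightarrow> 'h \<Rightarrow> real \<Rightarrow> real"
  ten :: "(nat \<Rightarrow> 'h) \<Rightarrow> 'g"
  Uemb :: "'g \<Rightarrow> (nat \<Rightarrow> real) \<Rightarrow> 'v"
  opA :: "((nat \<Rightarrow> real) \<Rightarrow> 'v) \<Rightarrow> (nat \<Rightarrow> real) \<Rightarrow> real"
  RA :: nat
  Aop :: "nat \<Rightarrow> nat \<Rightarrow> 'h \<Rightarrow> real \<Rightarrow> real"
  Lam :: "nat \<Rightarrow> 'l list"
  Dop :: "nat \<Rightarrow> 'l \<Rightarrow> 'h \<Rightarrow> real \<Rightarrow> real"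
  bco :: "nat \<Rightarrow> 'l \<Rightarrow> nat \<Rightarrow> real \<Rightarrow> real"
  pdim :: "nat \<Rightarrow> nat"
  kdim :: "nat \<Rightarrow> nat"
  net :: "nat \<Rightarrow> nat \<Rightarrow> real Matrix.vec \<Rightarrow> 'h"
  carr :: "nat list \<Rightarrow> real"
  ncol :: "nat \<Rightarrow> nat"
  zcol :: "nat \<Rightarrow> nat \<Rightarrow> real"
  rhs :: "(nat \<Rightarrow> real) \<Rightarrow> real"

definition ddim :: "('h, 'g, 'v, 'l, 'z) setting_scheme \<Rightarrow> nat" where
  "ddim S = dx S + dxi S"

subsection \<open>Domain\<close>

text \<open>Points of $\Omega$, $\Xi$ and $\mathcal D$ are extensional functions on their coordinates,
  carrying the product of the Lebesgue measures on the intervals.\<close>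

definition Ival :: "('h, 'g, 'v, 'l, 'z) setting_scheme \<Rightarrow> nat \<Rightarrow> real set" where
  "Ival S m = {zlo S m <..< zhi S m}"

definition cIval :: "('h, 'g, 'v, 'l, 'z) setting_scheme \<Rightarrow> nat \<Rightarrow> real set" where
  "cIval S m = {zlo S m .. zhi S m}"

definition Imeas :: "('h, 'g, 'v, 'l, 'z) setting_scheme \<Rightarrow> nat \<Rightarrow> real measure" where
  "Imeas S m = restrict_space lborel (Ival S m)"

definition Omeas :: "('h, 'g, 'v, 'l, 'z) setting_scheme \<Rightarrow> (nat \<Rightarrow> real) measure" where
  "Omeas S = PiM {..<dx S} (Imeas S)"

definition Xmeas :: "('h, 'g, 'v, 'l, 'z) setting_scheme \<Rightarrow> (nat \<Rightarrow> real) measure" where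
  "Xmeas S = PiM {dx S..<ddim S} (Imeas S)"

definition Dmeas :: "('h, 'g, 'v, 'l, 'z) setting_scheme \<Rightarrow> (nat \<Rightarrow> real) measure" where
  "Dmeas S = PiM {..<ddim S} (Imeas S)"

definition Dclosure :: "('h, 'g, 'v, 'l, 'z) setting_scheme \<Rightarrow> (nat \<Rightarrow> real) set" where
  "Dclosure S = PiE {..<ddim S} (cIval S)"

text \<open>The surface measure of $\partial\Omega$ on the face where coordinate \<open>m\<close> has the end value
  \<open>e\<close>.  Up to null sets $\partial\Omega$ is the disjoint union of its $2 d_x$ faces, so a map is
  bounded into $L^2(\partial\Omega)$ iff it is bounded into $L^2$ of every face.\<close>

definition face_meas ::
    "('h, 'g, 'v, 'l, 'z) setting_scheme \<Rightarrow> nat \<Rightarrow> real \<Rightarrow> (nat \<Rightarrow> real) measure" where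
  "face_meas S m e =
     distr (PiM ({..<dx S} - {m}) (Imeas S)) (PiM {..<dx S} (\<lambda>_. borel)) (\<lambda>x. x(m := e))"

definition domain_ok :: "('h, 'g, 'v, 'l, 'z) setting_scheme \<Rightarrow> bool" where
  "domain_ok S \<longleftrightarrow> 0 < dx S \<and> (\<forall>m<ddim S. zlo S m < zhi S m)"

subsection \<open>Spaces and operator\<close>

definition V_ok ::
    "('h, 'g, 'v::{real_inner, complete_space, second_countable_topology}, 'l, 'z) setting_scheme
     \<Rightarrow> bool" where
  "V_ok S \<longleftrightarrow>
     (\<forall>v. Vfun S v \<in> borel_measurable (Omeas S)) \<and>
     linear_ae UNIV (Omeas S) (Vfun S) \<and> injective_ae UNIV (Omeas S) (Vfun S) \<and>
     (\<forall>m<dx S. \<forall>e\<in>{zlo S m, zhi S m}.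
        bounded_linear_L2 UNIV (face_meas S m e) (trace_op S) \<and>
        (\<forall>v h. cont_rep (Omeas S) (PiE {..<dx S} (cIval S)) (Vfun S v) h \<longrightarrow>
           (AE x in face_meas S m e. trace_op S v x = h x)))"

definition Htuples :: "('h, 'g, 'v, 'l, 'z) setting_scheme \<Rightarrow> (nat \<Rightarrow> 'h) set" where
  "Htuples S = {v. \<forall>m<ddim S. v m \<in> Hsp S m}"

text \<open>The second and third clauses determine the Hilbert tensor product $H_1 \otimes\cdots\otimes
  H_d$ up to isometry; multilinearity of \<open>ten\<close> and the product formula for the norm follow.
  The last clause identifies $v_1 \otimes\cdots\otimes v_d$ with the function
  $\prod_m v_m(z_m)$ in $U$.\<close>

definition H_ok ::
    "('h::{real_inner, complete_space}, 'g::{real_inner, complete_space},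
      'v::{real_inner, complete_space, second_countable_topology}, 'l, 'z) setting_scheme
     \<Rightarrow> bool" where
  "H_ok S \<longleftrightarrow>
     (\<forall>m<ddim S. Real_Vector_Spaces.subspace (Hsp S m) \<and> closed (Hsp S m) \<and>
        bounded_linear_L2 (Hsp S m) (Imeas S m) (Hfun S m) \<and>
        injective_ae (Hsp S m) (Imeas S m) (Hfun S m)) \<and>
     (\<forall>v\<in>Htuples S. \<forall>w\<in>Htuples S.
        inner (ten S v) (ten S w) = (\<Prod>m<ddim S. inner (v m) (w m))) \<and>
     closure (Real_Vector_Spaces.span (ten S ` Htuples S)) = UNIV \<and>
     bounded_linear_L2 UNIV (Xmeas S) (Uemb S) \<and> injective_ae UNIV (Xmeas S) (Uemb S) \<and>
     (\<forall>u\<in>L2_fun (Xmeas S). \<forall>\<epsilon>>0. \<exists>g. L2_nrm (Xmeas S) (\<lambda>\<xi>. u \<xi> - Uemb S g \<xi>) < \<epsilon>) \<and>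
     (\<forall>v\<in>Htuples S. AE \<xi> in Xmeas S. AE x in Omeas S.
        Vfun S (Uemb S (ten S v) \<xi>) x =
          (\<Prod>m<ddim S. Hfun S m (v m) (merge {..<dx S} {dx S..<ddim S} (x, \<xi>) m)))"

lemma norm_ten:
  assumes "H_ok S" "v \<in> Htuples S"
  shows "norm (ten S v) = (\<Prod>m<ddim S. norm (v m))"
proof -
  have "(norm (ten S v))\<^sup>2 = (\<Prod>m<ddim S. norm (v m))\<^sup>2"
    using assms by (simp add: H_ok_def power2_norm_eq_inner prod_power_distrib)
  then show ?thesis
    by (simp add: prod_nonneg power2_eq_iff_nonneg)
qed

text \<open>\<open>T\<close> is the bounded operator $B_1 \otimes\cdots\otimes B_d : H \to L^2(\mathcal D)$, which is
  unique by density of the span of elementary tensors.\<close>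

definition is_tensor_op ::
    "('h::{real_inner, complete_space}, 'g::{real_inner, complete_space}, 'v, 'l, 'z) setting_scheme
     \<Rightarrow> (nat \<Rightarrow> 'h \<Rightarrow> real \<Rightarrow> real) \<Rightarrow> ('g \<Rightarrow> (nat \<Rightarrow> real) \<Rightarrow> real) \<Rightarrow> bool" where
  "is_tensor_op S B T \<longleftrightarrow>
     bounded_linear_L2 UNIV (Dmeas S) T \<and>
     (\<forall>v\<in>Htuples S. AE z in Dmeas S. T (ten S v) z = (\<Prod>m<ddim S. B m (v m) (z m)))"

definition operator_ok ::
    "('h::{real_inner, complete_space}, 'g::{real_inner, complete_space},
      'v::{real_inner, complete_space, second_countable_topology}, 'l, 'z) setting_scheme
     \<Rightarrow> bool" where
  "operator_ok S \<longleftrightarrow>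
     (\<forall>u\<in>L2_fun (Xmeas S). opA S u \<in> L2_fun (Dmeas S)) \<and>
     (\<forall>u\<in>L2_fun (Xmeas S). \<forall>u'\<in>L2_fun (Xmeas S). AE z in Dmeas S.
        opA S (\<lambda>\<xi>. u \<xi> + u' \<xi>) z = opA S u z + opA S u' z) \<and>
     (\<forall>r. \<forall>u\<in>L2_fun (Xmeas S). AE z in Dmeas S. opA S (\<lambda>\<xi>. r *\<^sub>R u \<xi>) z = r * opA S u z) \<and>
     (\<exists>C. \<forall>u\<in>L2_fun (Xmeas S). L2_nrm (Dmeas S) (opA S u) \<le> C * L2_nrm (Xmeas S) u) \<and>
     (\<forall>m<ddim S. \<forall>\<beta><RA S. bounded_linear_L2 (Hsp S m) (Imeas S m) (Aop S m \<beta>)) \<and>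
     (\<exists>T. (\<forall>\<beta><RA S. is_tensor_op S (\<lambda>m. Aop S m \<beta>) (T \<beta>)) \<and>
        (\<forall>g. AE z in Dmeas S. opA S (Uemb S g) z = (\<Sum>\<beta><RA S. T \<beta> g z)))"

text \<open>The only property of differential operators retained, besides boundedness and linearity, is
  that they are local: they map a function vanishing on an open interval to one vanishing there.\<close>

definition channels_ok ::
    "('h::{real_inner, complete_space}, 'g, 'v, 'l, 'z) setting_scheme \<Rightarrow> bool" where
  "channels_ok S \<longleftrightarrow>
     (\<forall>s<ddim S. distinct (Lam S s) \<and>
        (\<forall>l\<in>set (Lam S s).
           bounded_linear_L2 (Hsp S s) (Imeas S s) (Dop S s l) \<and>
           (\<forall>v\<in>Hsp S s. \<forall>a b. {a<..<b} \<subseteq> Ival S s \<longrightarrow>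
              (AE x in Imeas S s. x \<in> {a<..<b} \<longrightarrow> Hfun S s v x = 0) \<longrightarrow>
              (AE x in Imeas S s. x \<in> {a<..<b} \<longrightarrow> Dop S s l v x = 0)) \<and>
           (\<forall>\<beta><RA S. continuous_on (cIval S s) (bco S s l \<beta>))) \<and>
        (\<forall>\<beta><RA S. \<forall>v\<in>Hsp S s. AE x in Imeas S s.
           Aop S s \<beta> v x = (\<Sum>l\<in>set (Lam S s). bco S s l \<beta> x * Dop S s l v x)))"

subsection \<open>Architecture and collocation\<close>

definition params :: "('h, 'g, 'v, 'l, 'z) setting_scheme \<Rightarrow> (nat \<Rightarrow> real Matrix.vec) set" where
  "params S = {\<theta>. \<forall>m<ddim S. \<theta> m \<in> carrier_vec (pdim S m)}"

definition architecture_ok ::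
    "('h::{real_inner, complete_space}, 'g, 'v, 'l, 'z) setting_scheme \<Rightarrow> bool" where
  "architecture_ok S \<longleftrightarrow>
     (\<forall>m<ddim S. \<forall>a<kdim S m. \<forall>\<theta>\<in>carrier_vec (pdim S m).
        net S m a \<theta> \<in> Hsp S m \<and> differentiable_at_vec (pdim S m) (net S m a) \<theta>)"

definition collocation_ok ::
    "('h::{real_inner, complete_space}, 'g, 'v, 'l, 'z) setting_scheme \<Rightarrow> bool" where
  "collocation_ok S \<longleftrightarrow>
     (\<forall>m<ddim S. 0 < ncol S m \<and> (\<forall>i<ncol S m. zcol S m i \<in> Ival S m)) \<and>
     (\<forall>m<ddim S. \<forall>l\<in>set (Lam S m). \<forall>a<kdim S m. \<forall>\<theta>\<in>carrier_vec (pdim S m).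
        (\<exists>h. cont_rep (Imeas S m) (cIval S m) (Dop S m l (net S m a \<theta>)) h) \<and>
        (\<forall>j<pdim S m. \<exists>h. cont_rep (Imeas S m) (cIval S m)
           (Dop S m l (partial (pdim S m) (net S m a) \<theta> j)) h)) \<and>
     rhs S \<in> L2_fun (Dmeas S)"

definition separable_setting ::
    "('h::{real_inner, complete_space}, 'g::{real_inner, complete_space},
      'v::{real_inner, complete_space, second_countable_topology}, 'l, 'z) setting_scheme
     \<Rightarrow> bool" where
  "separable_setting S \<longleftrightarrow>
     domain_ok S \<and> V_ok S \<and> H_ok S \<and> operator_ok S \<and> channels_ok S \<and>
     architecture_ok S \<and> collocation_ok S"

definition nlist :: "('h, 'g, 'v, 'l, 'z) setting_scheme \<Rightarrow> nat list" where
  "nlist S = map (ncol S) [0..<ddim S]"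

definition klist :: "('h, 'g, 'v, 'l, 'z) setting_scheme \<Rightarrow> nat list" where
  "klist S = map (kdim S) [0..<ddim S]"

definition ND :: "('h, 'g, 'v, 'l, 'z) setting_scheme \<Rightarrow> nat" where
  "ND S = (\<Prod>m<ddim S. ncol S m)"

definition Ptot :: "('h, 'g, 'v, 'l, 'z) setting_scheme \<Rightarrow> nat" where
  "Ptot S = (\<Sum>m<ddim S. pdim S m)"

definition Nch :: "('h, 'g, 'v, 'l, 'z) setting_scheme \<Rightarrow> nat \<Rightarrow> nat" where
  "Nch S s = length (Lam S s) * ncol S s * kdim S s"

definition Neff :: "('h, 'g, 'v, 'l, 'z) setting_scheme \<Rightarrow> nat" where
  "Neff S = (\<Sum>s<ddim S. Nch S s)"

definition uhat ::
    "('h, 'g::real_vector, 'v, 'l, 'z) setting_scheme \<Rightarrow> (nat \<Rightarrow> real Matrix.vec) \<Rightarrow> 'g" where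
  "uhat S \<theta> = (\<Sum>as\<in>idx_set (klist S). carr S as *\<^sub>R ten S (\<lambda>m. net S m (as ! m) (\<theta> m)))"

definition grid_pt :: "('h, 'g, 'v, 'l, 'z) setting_scheme \<Rightarrow> nat \<Rightarrow> nat \<Rightarrow> real" where
  "grid_pt S i = restrict (\<lambda>m. zcol S m (multi_idx (nlist S) i ! m)) {..<ddim S}"

definition Deval ::
    "('h, 'g, 'v, 'l, 'z) setting_scheme \<Rightarrow> ((nat \<Rightarrow> real) \<Rightarrow> real) \<Rightarrow> (nat \<Rightarrow> real) \<Rightarrow> real" where
  "Deval S = pt_val (Dmeas S) (Dclosure S)"

definition Ieval ::
    "('h, 'g, 'v, 'l, 'z) setting_scheme \<Rightarrow> nat \<Rightarrow> (real \<Rightarrow> real) \<Rightarrow> real \<Rightarrow> real" where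
  "Ieval S m = pt_val (Imeas S m) (cIval S m)"

subsection \<open>Residual, Jacobian, Gramian and gradient\<close>

definition Jac ::
    "('h, 'g::real_normed_vector, 'v, 'l, 'z) setting_scheme \<Rightarrow> (nat \<Rightarrow> real Matrix.vec)
     \<Rightarrow> nat \<Rightarrow> real mat" where
  "Jac S \<theta> s = mat (ND S) (pdim S s) (\<lambda>(i, j).
     Deval S (opA S (Uemb S (partial (pdim S s) (\<lambda>\<tau>. uhat S (\<theta>(s := \<tau>))) (\<theta> s) j)))
       (grid_pt S i))"

definition Jfull ::
    "('h, 'g::real_normed_vector, 'v, 'l, 'z) setting_scheme \<Rightarrow> (nat \<Rightarrow> real Matrix.vec)
     \<Rightarrow> real mat" where
  "Jfull S \<theta> = hcat (ND S) (map (Jac S \<theta>) [0..<ddim S])"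

definition resid ::
    "('h, 'g::real_normed_vector, 'v, 'l, 'z) setting_scheme \<Rightarrow> (nat \<Rightarrow> real Matrix.vec)
     \<Rightarrow> real Matrix.vec" where
  "resid S \<theta> = Matrix.vec (ND S) (\<lambda>i.
     Deval S (opA S (Uemb S (uhat S \<theta>))) (grid_pt S i) - rhs S (grid_pt S i))"

text \<open>The discrete gradient of $\frac{1}{2 N_{\mathcal D}} \|\rho(\theta)\|_2^2$ is by definition
  $\frac{1}{N_{\mathcal D}} \mathrm J_\rho^\top \rho(\theta)$.\<close>

definition grad ::
    "('h, 'g::real_normed_vector, 'v, 'l, 'z) setting_scheme \<Rightarrow> (nat \<Rightarrow> real Matrix.vec)
     \<Rightarrow> real Matrix.vec" where
  "grad S \<theta> = (1 / real (ND S)) \<cdot>\<^sub>v (transpose_mat (Jfull S \<theta>) *\<^sub>v resid S \<theta>)"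

definition grad_block ::
    "('h, 'g::real_normed_vector, 'v, 'l, 'z) setting_scheme \<Rightarrow> (nat \<Rightarrow> real Matrix.vec)
     \<Rightarrow> nat \<Rightarrow> real Matrix.vec" where
  "grad_block S \<theta> s = (1 / real (ND S)) \<cdot>\<^sub>v (transpose_mat (Jac S \<theta> s) *\<^sub>v resid S \<theta>)"

definition Gram ::
    "('h, 'g::real_normed_vector, 'v, 'l, 'z) setting_scheme \<Rightarrow> (nat \<Rightarrow> real Matrix.vec)
     \<Rightarrow> real mat" where
  "Gram S \<theta> = (1 / real (ND S)) \<cdot>\<^sub>m (transpose_mat (Jfull S \<theta>) * Jfull S \<theta>)"

definition Gram_block ::
    "('h, 'g::real_normed_vector, 'v, 'l, 'z) setting_scheme \<Rightarrow> (nat \<Rightarrow> real Matrix.vec)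
     \<Rightarrow> nat \<Rightarrow> nat \<Rightarrow> real mat" where
  "Gram_block S \<theta> s t = (1 / real (ND S)) \<cdot>\<^sub>m (transpose_mat (Jac S \<theta> s) * Jac S \<theta> t)"

subsection \<open>Channel factors\<close>

text \<open>Entry \<open>m\<close> of the full multi-index sits at position \<open>m\<close> of $i_{-s}$ if \<open>m < s\<close>, and at
  position \<open>m - 1\<close> if \<open>m > s\<close>.\<close>

definition Emat ::
    "('h, 'g, 'v, 'l, 'z) setting_scheme \<Rightarrow> (nat \<Rightarrow> real Matrix.vec) \<Rightarrow> nat \<Rightarrow> nat \<Rightarrow> real mat" where
  "Emat S \<theta> s \<beta> = mat (\<Prod>m\<in>{..<ddim S} - {s}. ncol S m) (kdim S s) (\<lambda>(p, a).
     \<Sum>as\<in>{as \<in> idx_set (klist S). as ! s = a}. carr S as *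
       (\<Prod>m\<in>{..<ddim S} - {s}. Ieval S m (Aop S m \<beta> (net S m (as ! m) (\<theta> m)))
          (zcol S m (multi_idx (remove_nth s (nlist S)) p ! (if m < s then m else m - 1)))))"

text \<open>Positions \<open>q\<close> of pairs $(i_s, a_s)$ are $i_s k_s + a_s$, so the entries are recovered by
  \<open>q div kdim S s\<close> and \<open>q mod kdim S s\<close>.\<close>

definition Hmat ::
    "('h::real_normed_vector, 'g, 'v, 'l, 'z) setting_scheme \<Rightarrow> (nat \<Rightarrow> real Matrix.vec)
     \<Rightarrow> nat \<Rightarrow> 'l \<Rightarrow> real mat" where
  "Hmat S \<theta> s l = mat (ncol S s * kdim S s) (pdim S s) (\<lambda>(q, j).
     Ieval S s (Dop S s l (partial (pdim S s) (net S s (q mod kdim S s)) (\<theta> s) j))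
       (zcol S s (q div kdim S s)))"

definition Psi_chan ::
    "('h, 'g, 'v, 'l, 'z) setting_scheme \<Rightarrow> (nat \<Rightarrow> real Matrix.vec) \<Rightarrow> nat \<Rightarrow> 'l \<Rightarrow> real mat" where
  "Psi_chan S \<theta> s l = mat (ND S) (ncol S s * kdim S s) (\<lambda>(i, q).
     let is = multi_idx (nlist S) i; js = q div kdim S s; a = q mod kdim S s in
     if is ! s = js
     then (\<Sum>\<beta><RA S. bco S s l \<beta> (zcol S s js) *
             index_mat (Emat S \<theta> s \<beta>) (lex_pos (remove_nth s (nlist S)) (remove_nth s is), a))
     else 0)"

definition Psi_blk ::
    "('h, 'g, 'v, 'l, 'z) setting_scheme \<Rightarrow> (nat \<Rightarrow> real Matrix.vec) \<Rightarrow> nat \<Rightarrow> real mat" where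
  "Psi_blk S \<theta> s = hcat (ND S) (map (Psi_chan S \<theta> s) (Lam S s))"

definition C_blk ::
    "('h::real_normed_vector, 'g, 'v, 'l, 'z) setting_scheme \<Rightarrow> (nat \<Rightarrow> real Matrix.vec)
     \<Rightarrow> nat \<Rightarrow> real mat" where
  "C_blk S \<theta> s = vcat (pdim S s) (map (Hmat S \<theta> s) (Lam S s))"

definition Psi ::
    "('h, 'g, 'v, 'l, 'z) setting_scheme \<Rightarrow> (nat \<Rightarrow> real Matrix.vec) \<Rightarrow> real mat" where
  "Psi S \<theta> = hcat (ND S) (map (Psi_blk S \<theta>) [0..<ddim S])"

definition Cmat ::
    "('h::real_normed_vector, 'g, 'v, 'l, 'z) setting_scheme \<Rightarrow> (nat \<Rightarrow> real Matrix.vec)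
     \<Rightarrow> real mat" where
  "Cmat S \<theta> = diag_block_mat (map (C_blk S \<theta>) [0..<ddim S])"

definition Ups ::
    "('h, 'g, 'v, 'l, 'z) setting_scheme \<Rightarrow> (nat \<Rightarrow> real Matrix.vec) \<Rightarrow> real mat" where
  "Ups S \<theta> = (1 / real (ND S)) \<cdot>\<^sub>m (transpose_mat (Psi S \<theta>) * Psi S \<theta>)"

definition Ups_blk ::
    "('h, 'g, 'v, 'l, 'z) setting_scheme \<Rightarrow> (nat \<Rightarrow> real Matrix.vec) \<Rightarrow> nat \<Rightarrow> nat \<Rightarrow> real mat" where
  "Ups_blk S \<theta> s t = (1 / real (ND S)) \<cdot>\<^sub>m (transpose_mat (Psi_blk S \<theta> s) * Psi_blk S \<theta> t)"

definition Ups_chan ::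
    "('h, 'g, 'v, 'l, 'z) setting_scheme \<Rightarrow> (nat \<Rightarrow> real Matrix.vec) \<Rightarrow> nat \<Rightarrow> nat \<Rightarrow> 'l \<Rightarrow> 'l
     \<Rightarrow> real mat" where
  "Ups_chan S \<theta> s t l l' =
     (1 / real (ND S)) \<cdot>\<^sub>m (transpose_mat (Psi_chan S \<theta> s l) * Psi_chan S \<theta> t l')"

definition rho_c ::
    "('h, 'g::real_normed_vector, 'v, 'l, 'z) setting_scheme \<Rightarrow> (nat \<Rightarrow> real Matrix.vec)
     \<Rightarrow> real Matrix.vec" where
  "rho_c S \<theta> = (1 / real (ND S)) \<cdot>\<^sub>v (transpose_mat (Psi S \<theta>) *\<^sub>v resid S \<theta>)"

definition rho_c_blk ::
    "('h, 'g::real_normed_vector, 'v, 'l, 'z) setting_scheme \<Rightarrow> (nat \<Rightarrow> real Matrix.vec)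
     \<Rightarrow> nat \<Rightarrow> real Matrix.vec" where
  "rho_c_blk S \<theta> s = (1 / real (ND S)) \<cdot>\<^sub>v (transpose_mat (Psi_blk S \<theta> s) *\<^sub>v resid S \<theta>)"

definition rho_c_chan ::
    "('h, 'g::real_normed_vector, 'v, 'l, 'z) setting_scheme \<Rightarrow> (nat \<Rightarrow> real Matrix.vec)
     \<Rightarrow> nat \<Rightarrow> 'l \<Rightarrow> real Matrix.vec" where
  "rho_c_chan S \<theta> s l =
     (1 / real (ND S)) \<cdot>\<^sub>v (transpose_mat (Psi_chan S \<theta> s l) *\<^sub>v resid S \<theta>)"

end

theory Submission
  imports Defs "Jordan_Normal_Form.Matrix_Kernel"
begin

text \<open>By multilinearity of the tensor product, differentiating $u_\theta$ with respect to
  $\theta^s_j$ replaces $w_s^{a_s}$ by $\partial_{\theta^s_j} w_s^{a_s}$ in each summand.  Applying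
  $\mathcal A$ gives, almost everywhere, a finite sum of products of univariate functions
  $\mathcal A_m^{(\beta)} v_m$, each with the continuous representative
  $\sum_\ell b_{m,\ell}^{(\beta)} \mathcal D_m^\ell v_m$.  Continuous representatives are unique at
  interior points, so point values on the grid factorize; expanding the $s$-th factor into its channels
  gives $\mathrm J_s = \Psi_s^{\mathrm{ch}} \mathsf C_s^{\mathrm{ch}}$.  The rest is block matrix algebra,
  and $\operatorname{rank} (A^\top A) = \operatorname{rank} A$ follows from rank-nullity since both
  matrices have the same kernel.\<close>

section \<open>Multi-indices\<close>

text \<open>Multilinearity of \<open>ten\<close> is derived from its inner products. With all other
  factors fixed, they make \<open>ten\<close> an isometry up to a constant in the remaining factor,
  and both linearity and the derivative of the tensor come from that. The derivative of a factor
  must stay in \<open>Hsp S s\<close>, which closedness of this subspace guarantees. Each identity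
  between operators holds outside a null set that depends on its arguments, so only finitely many of
  them are combined before passing to point values. The factors other than the s-th are kept as
  values of \<open>Aop S m \<beta>\<close>: summed against \<open>carr\<close> over the remaining
  indices they are the entries of \<open>Emat\<close>. Grouping the full multi-indices by their s-th
  entry then produces the inner index (i_s, a_s), where the Kronecker delta in
  \<open>Psi_chan\<close> removes the sum over grid points.\<close>

lemma finite_idx_set: "finite (idx_set ns)"
proof (rule finite_subset)
  show "idx_set ns \<subseteq> multi_idx ns ` {..<prod_list ns}"
    by (metis image_eqI lessThan_iff lex_pos_less multi_idx_lex_pos subsetI)
qed simp

lemma idx_set_nth_less: "is \<in> idx_set ns \<Longrightarrow> m < length ns \<Longrightarrow> is ! m < ns ! m"
  by (auto simp: idx_set_def dest: list_all2_nthD2)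

lemma length_idx_set: "is \<in> idx_set ns \<Longrightarrow> length is = length ns"
  by (auto simp: idx_set_def dest: list_all2_lengthD)

lemma remove_nth_nth:
  assumes "s < length xs" "m < length xs" "m \<noteq> s"
  shows "remove_nth s xs ! (if m < s then m else m - 1) = xs ! m"
  using assms by (auto simp: remove_nth_def nth_append)

lemma remove_nth_in_idx_set:
  "is \<in> idx_set ns \<Longrightarrow> remove_nth s is \<in> idx_set (remove_nth s ns)"
  by (auto simp: idx_set_def remove_nth_def intro!: list_all2_appendI)

text \<open>Reconciles two forms of N_{-s}: \<open>lex_pos_less\<close> bounds positions by a
  product over a list, while the row count of \<open>Emat\<close> is a product over a set.\<close>

lemma prod_list_remove_nth:
  assumes "s < d"
  shows "prod_list (remove_nth s (map f [0..<d])) = (\<Prod>m\<in>{..<d} - {s}. f m)"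
proof -
  have "remove_nth s (map f [0..<d]) = map f ([0..<s] @ [Suc s..<d])"
    using assms by (simp add: remove_nth_def take_map drop_map)
  also have "prod_list \<dots> = prod f (set ([0..<s] @ [Suc s..<d]))"
    by (subst prod.distinct_set_conv_list) auto
  also have "set ([0..<s] @ [Suc s..<d]) = {..<d} - {s}"
    using assms by auto
  finally show ?thesis .
qed

text \<open>Quotient and remainder by \<open>k\<close> put the positions below \<open>n * k\<close>
  in bijection with the pairs (i, a). This undoes the flattening of the index (i_s, a_s).\<close>

lemma sum_div_mod:
  fixes f :: "nat \<Rightarrow> nat \<Rightarrow> 'a::comm_monoid_add"
  shows "(\<Sum>q<n * k. f (q div k) (q mod k)) = (\<Sum>i<n. \<Sum>a<k. f i a)"
proof -
  have "(\<Sum>q<n * k. f (q div k) (q mod k)) = (\<Sum>i<n. \<Sum>q\<in>{i * k..<i * k + k}. f (q div k) (q mod k))"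
    by (rule sum.nat_group[symmetric])
  also have "\<dots> = (\<Sum>i<n. \<Sum>a<k. f i a)"
  proof (rule sum.cong[OF refl])
    fix i
    have "(\<Sum>q\<in>{i * k..<i * k + k}. f (q div k) (q mod k))
        = (\<Sum>a\<in>{0..<k}. f ((i * k + a) div k) ((i * k + a) mod k))"
      by (subst sum.atLeastLessThan_shift_0) simp
    also have "\<dots> = (\<Sum>a<k. f i a)"
      by (intro sum.cong) auto
    finally show "(\<Sum>q\<in>{i * k..<i * k + k}. f (q div k) (q mod k)) = (\<Sum>a<k. f i a)" .
  qed
  finally show ?thesis .
qed


section \<open>Block matrices\<close>

lemma hcat_carrier:
  assumes "\<And>x. x \<in> set xs \<Longrightarrow> f x \<in> carrier_mat nr (nc x)"
  shows "hcat nr (map f xs) \<in> carrier_mat nr (\<Sum>x\<leftarrow>xs. nc x)"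
  using assms
proof (induction xs)
  case (Cons x xs)
  then have "hcat nr (map f xs) \<in> carrier_mat nr (\<Sum>x\<leftarrow>xs. nc x)" "f x \<in> carrier_mat nr (nc x)"
    by auto
  then show ?case by (auto simp: hcat_def append_cols_def)
qed (simp add: hcat_def)

lemma vcat_carrier:
  assumes "\<And>x. x \<in> set xs \<Longrightarrow> f x \<in> carrier_mat (nr x) nc"
  shows "vcat nc (map f xs) \<in> carrier_mat (\<Sum>x\<leftarrow>xs. nr x) nc"
  using assms
proof (induction xs)
  case (Cons x xs)
  then have "vcat nc (map f xs) \<in> carrier_mat (\<Sum>x\<leftarrow>xs. nr x) nc" "f x \<in> carrier_mat (nr x) nc"
    by auto
  then show ?case by (auto simp: vcat_def)
qed (simp add: vcat_def)

lemma diag_block_mat_carrier: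
  assumes "\<And>x. x \<in> set xs \<Longrightarrow> f x \<in> carrier_mat (nr x) (nc x)"
  shows "diag_block_mat (map f xs) \<in> carrier_mat (\<Sum>x\<leftarrow>xs. nr x) (\<Sum>x\<leftarrow>xs. nc x)"
proof -
  have "map dim_row (map f xs) = map nr xs" "map dim_col (map f xs) = map nc xs"
    using assms by auto
  then show ?thesis by (intro carrier_matI) (simp_all only: dim_diag_block_mat)
qed

section \<open>Products of concatenated matrices\<close>

lemma hcat_Cons: "hcat nr (A # As) = append_cols A (hcat nr As)"
  by (simp add: hcat_def)

lemma vcat_Cons: "vcat nc (A # As) = A @\<^sub>r vcat nc As"
  by (simp add: vcat_def)

text \<open>A horizontal concatenation is a four-block matrix whose lower blocks have no rows, a
  vertical one a four-block matrix whose right blocks have no columns. The product rule for four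
  blocks covers both, and three of the resulting blocks are empty.\<close>

lemma append_cols_mult_append_rows:
  fixes A1 A2 :: "'a::semiring_0 mat"
  assumes "A1 \<in> carrier_mat nr k1" "A2 \<in> carrier_mat nr k2"
    and "B1 \<in> carrier_mat k1 nc" "B2 \<in> carrier_mat k2 nc"
  shows "append_cols A1 A2 * (B1 @\<^sub>r B2) = A1 * B1 + A2 * B2"
proof -
  have "append_cols A1 A2 * (B1 @\<^sub>r B2) =
      four_block_mat (A1 * B1 + A2 * B2) (A1 * 0\<^sub>m k1 0 + A2 * 0\<^sub>m k2 0)
        (0\<^sub>m 0 k1 * B1 + 0\<^sub>m 0 k2 * B2) (0\<^sub>m 0 k1 * 0\<^sub>m k1 0 + 0\<^sub>m 0 k2 * 0\<^sub>m k2 0)"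
    using assms unfolding append_cols_def append_rows_def
    by (subst mult_four_block_mat[of _ nr k1 _ k2 _ 0 _ _ nc _ 0]) auto
  also have "\<dots> = A1 * B1 + A2 * B2"
    using assms by (intro eq_matI) auto
  finally show ?thesis .
qed

text \<open>Entrywise, because a list sum of matrices has no size-independent zero to start from;
  entries are also what \<open>Jac_eq\<close> compares.\<close>

lemma hcat_mult_vcat:
  fixes f g :: "'x \<Rightarrow> 'a::semiring_0 mat"
  assumes "\<And>x. x \<in> set xs \<Longrightarrow> f x \<in> carrier_mat nr (k x)"
    and "\<And>x. x \<in> set xs \<Longrightarrow> g x \<in> carrier_mat (k x) nc"
    and ij: "i < nr" "j < nc"
  shows "(hcat nr (map f xs) * vcat nc (map g xs)) $$ (i, j) = (\<Sum>x\<leftarrow>xs. (f x * g x) $$ (i, j))"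
  using assms(1,2)
proof (induction xs)
  case Nil
  show ?case using ij by (simp add: hcat_def vcat_def scalar_prod_def)
next
  case (Cons x xs)
  have c: "hcat nr (map f xs) \<in> carrier_mat nr (\<Sum>x\<leftarrow>xs. k x)"
    "vcat nc (map g xs) \<in> carrier_mat (\<Sum>x\<leftarrow>xs. k x) nc"
    using Cons.prems by (auto intro!: hcat_carrier vcat_carrier)
  have x: "f x \<in> carrier_mat nr (k x)" "g x \<in> carrier_mat (k x) nc"
    using Cons.prems by auto
  have "hcat nr (map f (x # xs)) * vcat nc (map g (x # xs))
      = f x * g x + hcat nr (map f xs) * vcat nc (map g xs)"
    using append_cols_mult_append_rows[OF x(1) c(1) x(2) c(2)] by (simp add: hcat_Cons vcat_Cons)
  then show ?case using Cons ij c x by simp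
qed

text \<open>The zero blocks annihilate the mixed products, so a block diagonal factor acts on each
  column block separately. This carries the blockwise factorization to the full Jacobian.\<close>

lemma append_cols_mult_diag:
  fixes A1 A2 :: "'a::semiring_0 mat"
  assumes "A1 \<in> carrier_mat nr k1" "A2 \<in> carrier_mat nr k2"
    and "B1 \<in> carrier_mat k1 n1" "B2 \<in> carrier_mat k2 n2"
  shows "append_cols A1 A2 * four_block_mat B1 (0\<^sub>m k1 n2) (0\<^sub>m k2 n1) B2
    = append_cols (A1 * B1) (A2 * B2)"
proof -
  have "append_cols A1 A2 * four_block_mat B1 (0\<^sub>m k1 n2) (0\<^sub>m k2 n1) B2 =
      four_block_mat (A1 * B1 + A2 * 0\<^sub>m k2 n1) (A1 * 0\<^sub>m k1 n2 + A2 * B2)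
        (0\<^sub>m 0 k1 * B1 + 0\<^sub>m 0 k2 * 0\<^sub>m k2 n1) (0\<^sub>m 0 k1 * 0\<^sub>m k1 n2 + 0\<^sub>m 0 k2 * B2)"
    using assms unfolding append_cols_def
    by (subst mult_four_block_mat[of _ nr k1 _ k2 _ 0 _ _ n1 _ n2]) auto
  also have "\<dots> = append_cols (A1 * B1) (A2 * B2)"
    using assms by (auto simp: append_cols_def)
  finally show ?thesis .
qed

lemma hcat_mult_diag_block_mat:
  fixes f g :: "'x \<Rightarrow> 'a::semiring_0 mat"
  assumes "\<And>x. x \<in> set xs \<Longrightarrow> f x \<in> carrier_mat nr (k x)"
    and "\<And>x. x \<in> set xs \<Longrightarrow> g x \<in> carrier_mat (k x) (nc x)"
  shows "hcat nr (map f xs) * diag_block_mat (map g xs) = hcat nr (map (\<lambda>x. f x * g x) xs)"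
  using assms
proof (induction xs)
  case Nil
  show ?case by (simp add: hcat_def)
next
  case (Cons x xs)
  have c: "hcat nr (map f xs) \<in> carrier_mat nr (\<Sum>x\<leftarrow>xs. k x)"
    "diag_block_mat (map g xs) \<in> carrier_mat (\<Sum>x\<leftarrow>xs. k x) (\<Sum>x\<leftarrow>xs. nc x)"
    using Cons.prems by (auto intro!: hcat_carrier diag_block_mat_carrier)
  have x: "f x \<in> carrier_mat nr (k x)" "g x \<in> carrier_mat (k x) (nc x)"
    using Cons.prems by auto
  show ?case
    using append_cols_mult_diag[OF x(1) c(1) x(2) c(2)] Cons carrier_matD[OF c(2)] carrier_matD[OF x(2)]
    by (simp add: hcat_Cons Let_def)
qed

section \<open>Transposes, scalar multiples and Gram matrices of concatenations\<close>

lemma transpose_append_cols: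
  assumes "A \<in> carrier_mat nr n1" "B \<in> carrier_mat nr n2"
  shows "transpose_mat (append_cols A B) = transpose_mat A @\<^sub>r transpose_mat B"
  using assms by (intro eq_matI) (auto simp: append_cols_def append_rows_def)

lemma transpose_hcat:
  assumes "\<And>x. x \<in> set xs \<Longrightarrow> f x \<in> carrier_mat nr (nc x)"
  shows "transpose_mat (hcat nr (map f xs)) = vcat nr (map (\<lambda>x. transpose_mat (f x)) xs)"
  using assms
proof (induction xs)
  case Nil
  show ?case by (simp add: hcat_def vcat_def)
next
  case (Cons x xs)
  have c: "f x \<in> carrier_mat nr (nc x)" "hcat nr (map f xs) \<in> carrier_mat nr (\<Sum>x\<leftarrow>xs. nc x)"
    using Cons.prems by (auto intro!: hcat_carrier)
  show ?case
    using transpose_append_cols[OF c] Cons by (simp add: hcat_Cons vcat_Cons)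
qed

lemma append_rows_mult:
  fixes A1 A2 B :: "'a::semiring_0 mat"
  assumes "A1 \<in> carrier_mat n1 k" "A2 \<in> carrier_mat n2 k" "B \<in> carrier_mat k nc"
  shows "(A1 @\<^sub>r A2) * B = (A1 * B) @\<^sub>r (A2 * B)"
proof -
  \<comment> \<open>Padding with blocks that have no rows or no columns turns the single factor
    \<open>B\<close> into a four-block matrix, so that the block product rule applies.\<close>
  have B: "B = four_block_mat B (0\<^sub>m k 0) (0\<^sub>m 0 nc) (0\<^sub>m 0 0)"
    using assms by (intro eq_matI) auto
  have "(A1 @\<^sub>r A2) * B = four_block_mat (A1 * B + 0\<^sub>m n1 0 * 0\<^sub>m 0 nc) (A1 * 0\<^sub>m k 0 + 0\<^sub>m n1 0 * 0\<^sub>m 0 0)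
      (A2 * B + 0\<^sub>m n2 0 * 0\<^sub>m 0 nc) (A2 * 0\<^sub>m k 0 + 0\<^sub>m n2 0 * 0\<^sub>m 0 0)"
    using assms unfolding append_rows_def
    by (subst B, subst mult_four_block_mat[of _ n1 k _ 0 _ n2 _ _ nc _ 0]) auto
  also have "\<dots> = (A1 * B) @\<^sub>r (A2 * B)"
    using assms by (auto simp: append_rows_def)
  finally show ?thesis .
qed

lemma vcat_mult:
  fixes f :: "'x \<Rightarrow> 'a::semiring_0 mat"
  assumes "\<And>x. x \<in> set xs \<Longrightarrow> f x \<in> carrier_mat (nr x) k" and B: "B \<in> carrier_mat k nc"
  shows "vcat k (map f xs) * B = vcat nc (map (\<lambda>x. f x * B) xs)"
  using assms(1)
proof (induction xs)
  case Nil
  show ?case using B by (simp add: vcat_def)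
next
  case (Cons x xs)
  have c: "f x \<in> carrier_mat (nr x) k" "vcat k (map f xs) \<in> carrier_mat (\<Sum>x\<leftarrow>xs. nr x) k"
    using Cons.prems by (auto intro!: vcat_carrier)
  show ?case
    using append_rows_mult[OF c B] Cons by (simp add: vcat_Cons)
qed

lemma mult_append_cols:
  fixes A B1 B2 :: "'a::semiring_0 mat"
  assumes "A \<in> carrier_mat nr k" "B1 \<in> carrier_mat k n1" "B2 \<in> carrier_mat k n2"
  shows "A * append_cols B1 B2 = append_cols (A * B1) (A * B2)"
proof -
  have A: "A = four_block_mat A (0\<^sub>m nr 0) (0\<^sub>m 0 k) (0\<^sub>m 0 0)"
    using assms by (intro eq_matI) auto
  have "A * append_cols B1 B2 = four_block_mat (A * B1 + 0\<^sub>m nr 0 * 0\<^sub>m 0 n1) (A * B2 + 0\<^sub>m nr 0 * 0\<^sub>m 0 n2)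
      (0\<^sub>m 0 k * B1 + 0\<^sub>m 0 0 * 0\<^sub>m 0 n1) (0\<^sub>m 0 k * B2 + 0\<^sub>m 0 0 * 0\<^sub>m 0 n2)"
    using assms unfolding append_cols_def
    by (subst A, subst mult_four_block_mat[of _ nr k _ 0 _ 0 _ _ n1 _ n2]) auto
  also have "\<dots> = append_cols (A * B1) (A * B2)"
    using assms by (auto simp: append_cols_def)
  finally show ?thesis .
qed

lemma mult_hcat:
  fixes f :: "'x \<Rightarrow> 'a::semiring_0 mat"
  assumes "\<And>x. x \<in> set xs \<Longrightarrow> f x \<in> carrier_mat k (nc x)" and A: "A \<in> carrier_mat nr k"
  shows "A * hcat k (map f xs) = hcat nr (map (\<lambda>x. A * f x) xs)"
  using assms(1)
proof (induction xs)
  case Nil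
  show ?case using A by (simp add: hcat_def)
next
  case (Cons x xs)
  have c: "f x \<in> carrier_mat k (nc x)" "hcat k (map f xs) \<in> carrier_mat k (\<Sum>x\<leftarrow>xs. nc x)"
    using Cons.prems by (auto intro!: hcat_carrier)
  show ?case
    using mult_append_cols[OF A c] Cons by (simp add: hcat_Cons)
qed

lemma smult_hcat:
  fixes f :: "'x \<Rightarrow> 'a::semiring_0 mat"
  assumes "\<And>x. x \<in> set xs \<Longrightarrow> f x \<in> carrier_mat nr (nc x)"
  shows "c \<cdot>\<^sub>m hcat nr (map f xs) = hcat nr (map (\<lambda>x. c \<cdot>\<^sub>m f x) xs)"
  using assms
proof (induction xs)
  case Nil
  show ?case by (simp add: hcat_def)
next
  case (Cons x xs)
  have "hcat nr (map f xs) \<in> carrier_mat nr (\<Sum>x\<leftarrow>xs. nc x)" "f x \<in> carrier_mat nr (nc x)"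
    using Cons.prems by (auto intro!: hcat_carrier)
  then have "c \<cdot>\<^sub>m append_cols (f x) (hcat nr (map f xs))
      = append_cols (c \<cdot>\<^sub>m f x) (c \<cdot>\<^sub>m hcat nr (map f xs))"
    by (intro eq_matI) (auto simp: append_cols_def)
  then show ?case using Cons by (simp add: hcat_Cons)
qed

lemma smult_vcat:
  fixes f :: "'x \<Rightarrow> 'a::semiring_0 mat"
  assumes "\<And>x. x \<in> set xs \<Longrightarrow> f x \<in> carrier_mat (nr x) nc"
  shows "c \<cdot>\<^sub>m vcat nc (map f xs) = vcat nc (map (\<lambda>x. c \<cdot>\<^sub>m f x) xs)"
  using assms
proof (induction xs)
  case Nil
  show ?case by (simp add: vcat_def)
next
  case (Cons x xs)
  have "vcat nc (map f xs) \<in> carrier_mat (\<Sum>x\<leftarrow>xs. nr x) nc" "f x \<in> carrier_mat (nr x) nc"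
    using Cons.prems by (auto intro!: vcat_carrier)
  then have "c \<cdot>\<^sub>m (f x @\<^sub>r vcat nc (map f xs)) = (c \<cdot>\<^sub>m f x) @\<^sub>r (c \<cdot>\<^sub>m vcat nc (map f xs))"
    by (intro eq_matI) (auto simp: append_rows_def)
  then show ?case using Cons by (simp add: vcat_Cons)
qed

text \<open>The two families are independent because one application has s different from t: the
  lemma serves the Gramian over parameter blocks, \<open>Ups\<close> over coordinates, and every
  \<open>Ups_blk\<close> over channels.\<close>

lemma gram_hcat:
  fixes f :: "'x \<Rightarrow> 'a::comm_semiring_0 mat" and g :: "'y \<Rightarrow> 'a mat"
  assumes f: "\<And>x. x \<in> set xs \<Longrightarrow> f x \<in> carrier_mat n (m x)"
    and g: "\<And>y. y \<in> set ys \<Longrightarrow> g y \<in> carrier_mat n (k y)"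
  shows "c \<cdot>\<^sub>m (transpose_mat (hcat n (map f xs)) * hcat n (map g ys)) =
    vcat (\<Sum>y\<leftarrow>ys. k y) (map (\<lambda>x. hcat (m x)
      (map (\<lambda>y. c \<cdot>\<^sub>m (transpose_mat (f x) * g y)) ys)) xs)"
proof -
  have G: "hcat n (map g ys) \<in> carrier_mat n (\<Sum>y\<leftarrow>ys. k y)"
    using g by (rule hcat_carrier)
  have ft: "transpose_mat (f x) \<in> carrier_mat (m x) n" if "x \<in> set xs" for x
    using f[OF that] by simp
  have "c \<cdot>\<^sub>m (transpose_mat (hcat n (map f xs)) * hcat n (map g ys))
      = c \<cdot>\<^sub>m vcat (\<Sum>y\<leftarrow>ys. k y) (map (\<lambda>x. transpose_mat (f x) * hcat n (map g ys)) xs)"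
    using transpose_hcat[of xs f n m, OF f] vcat_mult[of xs "\<lambda>x. transpose_mat (f x)", OF ft G]
    by simp
  also have "\<dots> = vcat (\<Sum>y\<leftarrow>ys. k y) (map (\<lambda>x. c \<cdot>\<^sub>m (transpose_mat (f x) * hcat n (map g ys))) xs)"
    using ft G by (intro smult_vcat) auto
  also have "map (\<lambda>x. c \<cdot>\<^sub>m (transpose_mat (f x) * hcat n (map g ys))) xs =
      map (\<lambda>x. hcat (m x) (map (\<lambda>y. c \<cdot>\<^sub>m (transpose_mat (f x) * g y)) ys)) xs"
  proof (intro map_cong refl)
    fix x assume "x \<in> set xs"
    have tg: "transpose_mat (f x) * g y \<in> carrier_mat (m x) (k y)" if "y \<in> set ys" for y
      using ft[OF \<open>x \<in> set xs\<close>] g[OF that] by simp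
    show "c \<cdot>\<^sub>m (transpose_mat (f x) * hcat n (map g ys)) =
        hcat (m x) (map (\<lambda>y. c \<cdot>\<^sub>m (transpose_mat (f x) * g y)) ys)"
      using mult_hcat[of ys g, OF g ft[OF \<open>x \<in> set xs\<close>]] smult_hcat[of ys "\<lambda>y. transpose_mat (f x) * g y", OF tg]
      by simp
  qed
  finally show ?thesis .
qed

text \<open>Serves both levels of stacking in \<open>rho_c\<close>: over coordinates and, inside one
  coordinate, over channels.\<close>

lemma transpose_hcat_mult_vec:
  fixes f :: "'x \<Rightarrow> 'a::comm_semiring_0 mat"
  assumes "\<And>x. x \<in> set xs \<Longrightarrow> f x \<in> carrier_mat n (m x)" and v: "v \<in> carrier_vec n"
  shows "c \<cdot>\<^sub>v (transpose_mat (hcat n (map f xs)) *\<^sub>v v) =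
    vstack (map (\<lambda>x. c \<cdot>\<^sub>v (transpose_mat (f x) *\<^sub>v v)) xs)"
  using assms(1)
proof (induction xs)
  case Nil
  show ?case using v by (auto simp: hcat_def vstack_def)
next
  case (Cons x xs)
  have H: "hcat n (map f xs) \<in> carrier_mat n (\<Sum>x\<leftarrow>xs. m x)" and x: "f x \<in> carrier_mat n (m x)"
    using Cons.prems by (auto intro!: hcat_carrier)
  have "c \<cdot>\<^sub>v (transpose_mat (append_cols (f x) (hcat n (map f xs))) *\<^sub>v v) =
      c \<cdot>\<^sub>v (transpose_mat (f x) *\<^sub>v v) @\<^sub>v c \<cdot>\<^sub>v (transpose_mat (hcat n (map f xs)) *\<^sub>v v)"
    using H x v mat_mult_append[of "transpose_mat (f x)" "m x" n "transpose_mat (hcat n (map f xs))" _ v]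
    by (intro eq_vecI) (auto simp: transpose_append_cols[OF x H])
  then show ?case using Cons by (simp add: hcat_Cons vstack_def)
qed


section \<open>Rank\<close>

text \<open>The image of the map given by \<open>A\<close> is the span of its columns. Expressing
  the rank through the kernel allows matrices with different numbers of rows but equally many
  columns to be compared.\<close>

lemma rank_nullity_mat:
  fixes A :: "'a::field mat"
  assumes A: "A \<in> carrier_mat nr nc"
  shows "vec_space.rank nr A + vectorspace.dim class_ring
    (module_vec TYPE('a) nc\<lparr>carrier := mat_kernel A\<rparr>) = nc"
proof -
  interpret N: vec_space "TYPE('a)" nc .
  interpret M: vec_space "TYPE('a)" nr .
  interpret T: linear_map class_ring "module_vec TYPE('a) nc" "module_vec TYPE('a) nr" "\<lambda>v. A *\<^sub>v v"
    using A by unfold_locales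
      (auto simp: module_hom_def module_vec_simps class_ring_simps
        mult_add_distrib_mat_vec[OF A] mult_mat_vec[OF A])
  have "T.ker = mat_kernel A"
    using A by (auto simp: T.ker_def mat_kernel_def module_vec_simps)
  moreover have "T.im = M.span (set (cols A))"
    using M.col_space_eq[OF A] A
    by (auto simp: T.im_def M.col_space_def module_vec_simps)
  ultimately show ?thesis
    using T.rank_nullity[OF N.fin_dim] by (simp add: M.rank_def N.dim_is_n)
qed

lemma smult_mat_mult_vec:
  fixes A :: "'a::comm_ring mat"
  assumes "A \<in> carrier_mat nr nc" "v \<in> carrier_vec nc"
  shows "(c \<cdot>\<^sub>m A) *\<^sub>v v = c \<cdot>\<^sub>v (A *\<^sub>v v)"
  using assms by (intro eq_vecI) auto

text \<open>Pairing A^T A v = 0 with v gives the sum of the squared entries of A v, which vanishes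
  over the reals only if A v = 0.\<close>

lemma mat_kernel_gram:
  fixes A :: "real mat"
  assumes A: "A \<in> carrier_mat nr nc" and c: "c \<noteq> 0"
  shows "mat_kernel (c \<cdot>\<^sub>m (transpose_mat A * A)) = mat_kernel A"
proof (rule Set.set_eqI)
  fix v
  show "v \<in> mat_kernel (c \<cdot>\<^sub>m (transpose_mat A * A)) \<longleftrightarrow> v \<in> mat_kernel A"
  proof (cases "v \<in> carrier_vec nc")
    case v: True
    have "c \<cdot>\<^sub>m (transpose_mat A * A) *\<^sub>v v = c \<cdot>\<^sub>v ((transpose_mat A * A) *\<^sub>v v)"
      using A v by (intro smult_mat_mult_vec) auto
    then have eq: "c \<cdot>\<^sub>m (transpose_mat A * A) *\<^sub>v v = c \<cdot>\<^sub>v (transpose_mat A *\<^sub>v (A *\<^sub>v v))"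
      using A v by simp
    have "A *\<^sub>v v = 0\<^sub>v nr" if "c \<cdot>\<^sub>v (transpose_mat A *\<^sub>v (A *\<^sub>v v)) = 0\<^sub>v nc"
    proof -
      have w: "A *\<^sub>v v \<in> carrier_vec nr" "transpose_mat A *\<^sub>v (A *\<^sub>v v) \<in> carrier_vec nc"
        using A v by auto
      have "0 = (c \<cdot>\<^sub>v (transpose_mat A *\<^sub>v (A *\<^sub>v v))) \<bullet> v"
        using that v by simp
      also have "\<dots> = c * ((A *\<^sub>v v) \<bullet> (A *\<^sub>v v))"
        using w v transpose_vec_mult_scalar[OF A v w(1)] by simp
      finally have "(A *\<^sub>v v) \<bullet> (A *\<^sub>v v) = 0"
        using c by simp
      then have "(\<Sum>i = 0..<nr. vec_index (A *\<^sub>v v) i * vec_index (A *\<^sub>v v) i) = 0"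
        using w(1) by (simp only: scalar_prod_def carrier_vecD)
      then have "\<forall>i\<in>{0..<nr}. vec_index (A *\<^sub>v v) i * vec_index (A *\<^sub>v v) i = 0"
        by (subst (asm) sum_nonneg_eq_0_iff) auto
      then show ?thesis
        using A w(1) by (intro eq_vecI) auto
    qed
    then show ?thesis
      using A v c by (auto simp: mat_kernel_def eq)
  qed (use A in \<open>auto simp: mat_kernel_def\<close>)
qed

lemma rank_gram:
  fixes A :: "real mat"
  assumes A: "A \<in> carrier_mat nr nc" and c: "c \<noteq> 0"
  shows "mat_rank (c \<cdot>\<^sub>m (transpose_mat A * A)) = mat_rank A"
proof -
  have G: "c \<cdot>\<^sub>m (transpose_mat A * A) \<in> carrier_mat nc nc"
    using A by simp
  show ?thesis
    using rank_nullity_mat[OF A] rank_nullity_mat[OF G] A by (simp add: mat_kernel_gram[OF A c])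
qed

text \<open>The columns of the product lie in the column space of \<open>A\<close>, which gives the
  bound \<open>k\<close>; the ambient dimension and the number of columns give the other
  two.\<close>

lemma rank_le_min:
  fixes A :: "'a::field mat"
  assumes A: "A \<in> carrier_mat nr k" and B: "B \<in> carrier_mat k nc"
  shows "mat_rank (A * B) \<le> Min {nr, k, nc}"
proof -
  interpret V: vec_space "TYPE('a)" nr .
  have AB: "A * B \<in> carrier_mat nr nc" using A B by simp
  have sub: "V.col_space (A * B) \<subseteq> V.col_space A"
    using A B unfolding V.col_space_eq[OF A] V.col_space_eq[OF AB]
    by (auto intro!: bexI[of _ "B *\<^sub>v _"])
  have cA: "set (cols A) \<subseteq> carrier_vec nr" and cAB: "set (cols (A * B)) \<subseteq> carrier_vec nr"
    using A AB cols_dim by blast+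
  have sA: "subspace class_ring (V.span (set (cols A))) V.V"
    and sAB: "subspace class_ring (V.span (set (cols (A * B)))) V.V"
    using V.span_is_subspace cA cAB by auto
  \<comment> \<open>The smaller span is regarded as a subspace of the larger one rather than of the
    ambient space, so its dimension is bounded by the rank of \<open>A\<close>.\<close>
  have "V.rank (A * B) \<le> V.rank A"
    unfolding V.rank_def
    using vectorspace.subspace_dim[OF V.subspace_is_vs[OF sA] V.nested_subspaces[OF sA sAB]
        V.fin_dim_span_cols[OF A]] sub V.fin_dim_span_cols[OF AB]
    by (auto simp: V.col_space_def)
  moreover have "V.rank A \<le> k" "V.rank (A * B) \<le> nc"
    using V.rank_le_nc A AB by auto
  moreover have "V.rank (A * B) \<le> nr"
    unfolding V.rank_def
    using V.subspace_dim[OF sAB V.fin_dim V.fin_dim_span_cols[OF AB]] by (simp add: V.dim_is_n)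
  ultimately show ?thesis using A by simp
qed


section \<open>Continuous representatives\<close>

text \<open>If every neighbourhood of \<open>x\<close> meets \<open>K\<close> in a set of positive measure, then two continuous
  representatives agree at \<open>x\<close>, so that the description in \<^const>\<open>pt_val\<close> denotes.\<close>

lemma pt_val_eq:
  assumes h: "cont_rep M K f h" and x: "x \<in> K"
    and thick: "\<And>U. open U \<Longrightarrow> x \<in> U \<Longrightarrow> \<exists>B\<in>sets M. B \<subseteq> K \<inter> U \<and> emeasure M B \<noteq> 0"
  shows "pt_val M K f x = h x"
  unfolding pt_val_def
proof (rule the_equality)
  show "\<exists>k. cont_rep M K f k \<and> k x = h x" using h by blast
next
  fix y assume "\<exists>k. cont_rep M K f k \<and> k x = y"
  then obtain k where k: "cont_rep M K f k" and y: "k x = y" by blast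
  show "y = h x"
  proof (rule ccontr)
    assume "y \<noteq> h x"
    \<comment> \<open>A difference that is nonzero at \<open>x\<close> stays nonzero on
      \<open>K\<close> near \<open>x\<close>, yet it vanishes almost everywhere; the set
      \<open>B\<close> of positive measure contradicts this.\<close>
    have "continuous_on K (\<lambda>z. k z - h z)"
      using h k unfolding cont_rep_def by (intro continuous_on_diff) auto
    moreover have "open (- {0::real})" "k x - h x \<in> - {0}"
      using \<open>y \<noteq> h x\<close> y by auto
    ultimately obtain U where U: "open U" "x \<in> U" "\<And>z. z \<in> K \<Longrightarrow> z \<in> U \<Longrightarrow> k z - h z \<in> - {0}"
      using x unfolding continuous_on_topological by meson
    obtain B where B: "B \<in> sets M" "B \<subseteq> K \<inter> U" "emeasure M B \<noteq> 0"
      using thick U by blast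
    have "AE z in M. k z = h z"
      using h k unfolding cont_rep_def by (auto elim: AE_mp)
    then have "AE z in M. z \<notin> B"
      by eventually_elim (use B(2) U(3) in auto)
    then have "emeasure M B = 0"
      using B(1) AE_iff_measurable[of B M "\<lambda>z. z \<notin> B"] sets.sets_into_space[of B M] by auto
    then show False using B(3) by simp
  qed
qed

section \<open>Positive measure near points of the intervals and of the box\<close>

lemma emeasure_Imeas:
  "X \<in> sets borel \<Longrightarrow> X \<subseteq> Ival S m \<Longrightarrow> emeasure (Imeas S m) X = emeasure lborel X"
  unfolding Imeas_def Ival_def by (subst emeasure_restrict_space) auto

lemma sets_Imeas: "X \<in> sets borel \<Longrightarrow> X \<subseteq> Ival S m \<Longrightarrow> X \<in> sets (Imeas S m)"
  unfolding Imeas_def Ival_def by (subst sets_restrict_space_iff) auto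

lemma space_Imeas: "space (Imeas S m) = Ival S m"
  by (simp add: Imeas_def space_restrict_space)

lemma emeasure_lborel_open_neq_0:
  fixes X :: "'a::euclidean_space set"
  assumes "open X" "X \<noteq> {}"
  shows "emeasure lborel X \<noteq> 0"
proof
  assume "emeasure lborel X = 0"
  then have "X \<in> null_sets lebesgue"
    using assms by (auto simp: null_sets_def)
  then have "negligible X" by (simp add: negligible_iff_null_sets)
  then show False using assms open_not_negligible by blast
qed

text \<open>Stated for every \<open>m\<close>, since \<open>product_sigma_finite\<close> ranges over
  all coordinates, including those from \<open>ddim S\<close> on, whose end points are
  arbitrary.\<close>

lemma finite_measure_Imeas: "finite_measure (Imeas S m)"
proof
  have "emeasure (Imeas S m) (Ival S m) = emeasure lborel {zlo S m <..< zhi S m}"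
    by (subst emeasure_Imeas) (auto simp: Ival_def)
  \<comment> \<open>With the end points in reverse order the interval is empty and has measure
    0.\<close>
  also have "\<dots> \<noteq> \<infinity>"
    by (cases "zlo S m \<le> zhi S m") auto
  finally show "emeasure (Imeas S m) (space (Imeas S m)) \<noteq> \<infinity>"
    by (simp add: space_Imeas)
qed

lemma product_sigma_finite_Imeas: "product_sigma_finite (Imeas S)"
  unfolding product_sigma_finite_def
  using finite_measure.axioms(1)[OF finite_measure_Imeas] by blast

lemma Ieval_eq:
  assumes "cont_rep (Imeas S m) (cIval S m) f h" "x \<in> Ival S m"
  shows "Ieval S m f x = h x"
  unfolding Ieval_def
proof (rule pt_val_eq[OF assms(1)])
  show "x \<in> cIval S m" using assms(2) by (auto simp: Ival_def cIval_def)
  fix U assume U: "open U" "x \<in> U"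
  \<comment> \<open>The witness of positive measure is a nonempty open set, as \<open>x\<close> lies
    in the open interval.\<close>
  have o: "open (U \<inter> Ival S m)" "U \<inter> Ival S m \<noteq> {}"
    using U assms(2) by (auto simp: Ival_def)
  show "\<exists>B\<in>sets (Imeas S m). B \<subseteq> cIval S m \<inter> U \<and> emeasure (Imeas S m) B \<noteq> 0"
    using o emeasure_lborel_open_neq_0[OF o]
    by (intro bexI[of _ "U \<inter> Ival S m"] conjI)
      (auto intro!: sets_Imeas simp: emeasure_Imeas Ival_def cIval_def)
qed

text \<open>Points are functions on all natural numbers, so a neighbourhood also restricts the
  coordinates from \<open>ddim S\<close> on. There all extensional points share the value of
  \<open>z\<close>, so the box \<open>?B\<close> stays inside the neighbourhood; its measure is a
  finite product of nonzero factors.\<close>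

lemma Deval_eq:
  assumes "cont_rep (Dmeas S) (Dclosure S) f h" and z: "z \<in> PiE {..<ddim S} (Ival S)"
  shows "Deval S f z = h z"
  unfolding Deval_def
proof (rule pt_val_eq[OF assms(1)])
  interpret product_sigma_finite "Imeas S" by (rule product_sigma_finite_Imeas)
  show "z \<in> Dclosure S"
    using z by (force simp: Dclosure_def PiE_def Pi_def Ival_def cIval_def)
  fix U :: "(nat \<Rightarrow> real) set" assume U: "open U" "z \<in> U"
  obtain X where X: "z \<in> PiE UNIV X" "\<And>i. open (X i)" "PiE UNIV X \<subseteq> U"
    using product_topology_open_contains_basis[OF U(1)[unfolded open_fun_def] U(2)]
    unfolding open_openin[symmetric] by blast
  let ?Y = "\<lambda>m. X m \<inter> Ival S m"
  let ?B = "PiE {..<ddim S} ?Y"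
  have o: "open (?Y m)" for m using X(2) by (auto simp: Ival_def)
  have Y: "?Y m \<in> sets (Imeas S m)" for m
    using o[of m] by (intro sets_Imeas) auto
  have pos: "emeasure (Imeas S m) (?Y m) \<noteq> 0" if "m < ddim S" for m
  proof -
    have "z m \<in> ?Y m" using X(1) z that by (auto simp: PiE_def Pi_def)
    then show ?thesis
      using o[of m] emeasure_lborel_open_neq_0[OF o, of m] by (subst emeasure_Imeas) auto
  qed
  have "?B \<subseteq> Dclosure S"
    by (force simp: Dclosure_def PiE_def Pi_def Ival_def cIval_def)
  moreover have "?B \<subseteq> PiE UNIV X"
  proof
    fix y assume y: "y \<in> ?B"
    have "y i \<in> X i" for i
    proof (cases "i < ddim S")
      case False
      then have "y i = z i" using y z by (auto simp: PiE_def extensional_def)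
      then show ?thesis using X(1) by (auto simp: PiE_def)
    qed (use y in \<open>auto simp: PiE_def Pi_def\<close>)
    then show "y \<in> PiE UNIV X" by (auto simp: PiE_def)
  qed
  moreover have "emeasure (Dmeas S) ?B \<noteq> 0"
    using Y pos unfolding Dmeas_def by (subst emeasure_PiM) auto
  moreover have "?B \<in> sets (Dmeas S)"
    using Y unfolding Dmeas_def by (intro sets_PiM_I_finite) auto
  ultimately show "\<exists>B\<in>sets (Dmeas S). B \<subseteq> Dclosure S \<inter> U \<and> emeasure (Dmeas S) B \<noteq> 0"
    using X(3) by (intro bexI[of _ ?B] conjI Int_greatest) simp_all
qed

text \<open>The exceptional set lies in a box with a null side in direction \<open>m\<close>, whose
  product measure has a factor 0.\<close>

lemma AE_Dmeas_component:
  assumes P: "AE x in Imeas S m. P x" and m: "m < ddim S"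
  shows "AE z in Dmeas S. P (z m)"
proof -
  interpret product_sigma_finite "Imeas S" by (rule product_sigma_finite_Imeas)
  obtain N where N: "N \<in> null_sets (Imeas S m)" "{x \<in> space (Imeas S m). \<not> P x} \<subseteq> N"
    using P by (auto simp: eventually_ae_filter)
  let ?X = "\<lambda>i. if i = m then N else space (Imeas S i)"
  have "emeasure (Dmeas S) (PiE {..<ddim S} ?X) = (\<Prod>i<ddim S. emeasure (Imeas S i) (?X i))"
    using N(1) unfolding Dmeas_def by (intro emeasure_PiM) auto
  also have "\<dots> = 0"
    using N(1) m by (intro prod_zero) auto
  finally have "PiE {..<ddim S} ?X \<in> null_sets (Dmeas S)"
    using N(1) unfolding Dmeas_def by (auto simp: null_sets_def intro!: sets_PiM_I_finite)
  moreover have "{z \<in> space (Dmeas S). \<not> P (z m)} \<subseteq> PiE {..<ddim S} ?X"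
    using N(2) m by (auto simp: Dmeas_def space_PiM PiE_def Pi_def)
  ultimately show ?thesis by (auto simp: eventually_ae_filter)
qed


section \<open>Derivatives in one tensor factor\<close>

text \<open>\<open>partial\<close> comes from \<open>vector_derivative\<close>, which is meaningful
  only once a derivative exists. Restricting the Frechet estimate to multiples of the j-th unit
  vector provides one.\<close>

lemma has_vector_derivative_partial:
  assumes "differentiable_at_vec P F \<theta>" and \<theta>: "\<theta> \<in> carrier_vec P" and j: "j < P"
  shows "((\<lambda>t. F (\<theta> + t \<cdot>\<^sub>v unit_vec P j)) has_vector_derivative partial P F \<theta> j) (at 0)"
proof -
  let ?h = "\<lambda>t. t \<cdot>\<^sub>v (unit_vec P j :: real Matrix.vec)"
  obtain g where g: "\<And>\<epsilon>. \<epsilon> > 0 \<Longrightarrow> \<exists>\<delta>>0. \<forall>h\<in>carrier_vec P. L2_set (vec_index h) {..<P} < \<delta> \<longrightarrow>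
        norm (F (\<theta> + h) - F \<theta> - (\<Sum>j<P. vec_index h j *\<^sub>R g j))
          \<le> \<epsilon> * L2_set (vec_index h) {..<P}"
    using assms(1) unfolding differentiable_at_vec_def by blast
  \<comment> \<open>The increment \<open>?h t\<close> has Euclidean norm |t| and, below, linear term
    \<open>t *\<^sub>R g j\<close>, so the Frechet estimate becomes the one-variable one.\<close>
  have L2: "L2_set (vec_index (?h t)) {..<P} = \<bar>t\<bar>" for t
  proof -
    have "(\<Sum>i<P. (vec_index (?h t) i)\<^sup>2) = (\<Sum>i<P. if i = j then t\<^sup>2 else 0)"
      using j by (intro sum.cong) (auto simp: unit_vec_def)
    then show ?thesis using j by (simp add: L2_set_def)
  qed
  have S: "(\<Sum>i<P. vec_index (?h t) i *\<^sub>R g i) = t *\<^sub>R g j" for t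
  proof -
    have "(\<Sum>i<P. vec_index (?h t) i *\<^sub>R g i) = (\<Sum>i<P. if i = j then t *\<^sub>R g j else 0)"
      using j by (intro sum.cong) (auto simp: unit_vec_def)
    then show ?thesis using j by simp
  qed
  have "((\<lambda>t. F (\<theta> + ?h t)) has_vector_derivative g j) (at 0)"
    unfolding has_vector_derivative_def has_derivative_at_alt
  proof (intro conjI allI impI)
    fix e :: real assume "e > 0"
    from g[OF this] obtain d where "d > 0" and d: "\<And>h. h \<in> carrier_vec P \<Longrightarrow>
        L2_set (vec_index h) {..<P} < d \<Longrightarrow>
        norm (F (\<theta> + h) - F \<theta> - (\<Sum>j<P. vec_index h j *\<^sub>R g j)) \<le> e * L2_set (vec_index h) {..<P}"
      by blast
    have "\<theta> + ?h 0 = \<theta>" using \<theta> by (intro eq_vecI) auto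
    moreover have "norm (F (\<theta> + ?h t) - F \<theta> - t *\<^sub>R g j) \<le> e * \<bar>t\<bar>" if "\<bar>t\<bar> < d" for t
      using d[of "?h t"] that unfolding L2 S by simp
    ultimately show "\<exists>d>0. \<forall>t. norm (t - 0) < d \<longrightarrow>
        norm (F (\<theta> + ?h t) - F (\<theta> + ?h 0) - (t - 0) *\<^sub>R g j) \<le> e * norm (t - 0)"
      using \<open>d > 0\<close> by (intro exI[of _ d]) auto
  qed (simp add: bounded_linear_scaleR_left)
  then show ?thesis unfolding partial_def by (metis vector_derivative_at)
qed

text \<open>Difference quotients stay in the subspace, and their limit stays in it by
  closedness.\<close>

lemma has_vector_derivative_in_closed_subspace:
  fixes g :: "real \<Rightarrow> 'a::real_normed_vector"
  assumes V: "Real_Vector_Spaces.subspace V" "closed V" and g: "\<And>t. g t \<in> V"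
    and d: "(g has_vector_derivative g') (at x)"
  shows "g' \<in> V"
proof (rule Lim_in_closed_set[OF V(2)])
  show "((\<lambda>t. (g t - g x) /\<^sub>R (t - x)) \<longlongrightarrow> g') (at x)"
    using d unfolding has_vector_derivative_def has_derivative_iff_norm
  proof (elim conjE)
    assume l: "((\<lambda>t. norm (g t - g x - (t - x) *\<^sub>R g') / norm (t - x)) \<longlongrightarrow> 0) (at x)"
    have "\<forall>\<^sub>F t in at x. norm (g t - g x - (t - x) *\<^sub>R g') / norm (t - x)
        = norm ((g t - g x) /\<^sub>R (t - x) - g')"
      unfolding eventually_at_filter
    proof (intro always_eventually allI impI)
      fix t assume "t \<noteq> x"
      then have "(g t - g x) /\<^sub>R (t - x) - g' = (g t - g x - (t - x) *\<^sub>R g') /\<^sub>R (t - x)"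
        by (simp add: scaleR_right_diff_distrib)
      then show "norm (g t - g x - (t - x) *\<^sub>R g') / norm (t - x) = norm ((g t - g x) /\<^sub>R (t - x) - g')"
        by (simp add: divide_inverse mult.commute)
    qed
    from Lim_transform_eventually[OF l this] show ?thesis
      by (simp add: tendsto_norm_zero_iff LIM_zero_iff)
  qed
  show "\<forall>\<^sub>F t in at x. (g t - g x) /\<^sub>R (t - x) \<in> V"
    using V(1) g by (auto intro!: always_eventually subspace_scale subspace_diff)
qed auto

lemma Htuples_upd:
  "v \<in> Htuples S \<Longrightarrow> x \<in> Hsp S s \<Longrightarrow> v(s := x) \<in> Htuples S"
  by (auto simp: Htuples_def)

text \<open>With the other factors fixed, the inner product of tensors is that of the s-th factors
  times a constant. Linearity in this factor and the derivative both rest on this.\<close>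

lemma inner_ten_upd:
  assumes "H_ok S" "v \<in> Htuples S" "s < ddim S" "x \<in> Hsp S s" "y \<in> Hsp S s"
  shows "inner (ten S (v(s := x))) (ten S (v(s := y)))
    = inner x y * (\<Prod>m\<in>{..<ddim S} - {s}. inner (v m) (v m))"
proof -
  have "inner (ten S (v(s := x))) (ten S (v(s := y)))
      = (\<Prod>m<ddim S. inner ((v(s := x)) m) ((v(s := y)) m))"
    using assms(1) Htuples_upd[OF assms(2)] assms(4,5) by (simp add: H_ok_def)
  also have "\<dots> = inner x y * (\<Prod>m\<in>{..<ddim S} - {s}. inner ((v(s := x)) m) ((v(s := y)) m))"
    using assms(3) by (subst prod.remove[of _ s]) auto
  also have "(\<Prod>m\<in>{..<ddim S} - {s}. inner ((v(s := x)) m) ((v(s := y)) m))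
      = (\<Prod>m\<in>{..<ddim S} - {s}. inner (v m) (v m))"
    by (intro prod.cong) auto
  finally show ?thesis .
qed

text \<open>Both sides have the same inner product with every tensor of this kind, so the norm of their
  difference vanishes.\<close>

lemma ten_upd_diff_scaleR:
  assumes "H_ok S" "v \<in> Htuples S" "s < ddim S" "x \<in> Hsp S s" "y \<in> Hsp S s"
  shows "ten S (v(s := x - r *\<^sub>R y)) = ten S (v(s := x)) - r *\<^sub>R ten S (v(s := y))"
proof -
  have V: "Real_Vector_Spaces.subspace (Hsp S s)" using assms(1,3) by (simp add: H_ok_def)
  have w: "x - r *\<^sub>R y \<in> Hsp S s"
    using assms V by (intro subspace_diff subspace_scale)
  note i = inner_ten_upd[OF assms(1-3)]
  let ?D = "ten S (v(s := x - r *\<^sub>R y)) - (ten S (v(s := x)) - r *\<^sub>R ten S (v(s := y)))"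
  \<comment> \<open>Every term of the expansion falls under \<open>inner_ten_upd\<close>. The
    constant factors out and leaves the squared norm of \<open>x - r *\<^sub>R y\<close> minus
    itself.\<close>
  have "inner ?D ?D = 0"
    using assms(4,5) w
    by (simp add: inner_diff_left inner_diff_right i algebra_simps)
  then show ?thesis by simp
qed

text \<open>By linearity in the s-th factor and \<open>norm_ten\<close>, the remainder of the tensor
  has the norm of the remainder of \<open>g\<close> times the constant \<open>?K\<close>.\<close>

lemma ten_has_vector_derivative:
  assumes H: "H_ok S" "v \<in> Htuples S" "s < ddim S"
    and g: "\<And>t. g t \<in> Hsp S s" and d: "(g has_vector_derivative g') (at t0)"
  shows "((\<lambda>t. ten S (v(s := g t))) has_vector_derivative ten S (v(s := g'))) (at t0)"
proof -
  have V: "Real_Vector_Spaces.subspace (Hsp S s)" "closed (Hsp S s)"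
    using H(1,3) by (auto simp: H_ok_def)
  have g': "g' \<in> Hsp S s"
    using has_vector_derivative_in_closed_subspace[OF V g d] .
  let ?K = "\<Prod>m\<in>{..<ddim S} - {s}. norm (v m)"
  have K: "norm (ten S (v(s := x))) = norm x * ?K" if "x \<in> Hsp S s" for x
  proof -
    have "norm (ten S (v(s := x))) = (\<Prod>m<ddim S. norm ((v(s := x)) m))"
      using norm_ten H(1) Htuples_upd[OF H(2) that] by blast
    also have "\<dots> = norm x * (\<Prod>m\<in>{..<ddim S} - {s}. norm ((v(s := x)) m))"
      using H(3) by (subst prod.remove[of _ s]) auto
    also have "(\<Prod>m\<in>{..<ddim S} - {s}. norm ((v(s := x)) m)) = ?K"
      by (intro prod.cong) auto
    finally show ?thesis .
  qed
  have eq: "norm (ten S (v(s := g t)) - ten S (v(s := g t0)) - (t - t0) *\<^sub>R ten S (v(s := g')))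
      = norm (g t - g t0 - (t - t0) *\<^sub>R g') * ?K" for t
  proof -
    have m: "g t - g t0 \<in> Hsp S s" "g t - g t0 - (t - t0) *\<^sub>R g' \<in> Hsp S s"
      using V(1) g g' by (auto intro!: subspace_diff subspace_scale)
    \<comment> \<open>Linearity is used twice: with r = 1 for the increment, then with r = t - t0
      for the linear term.\<close>
    have "ten S (v(s := g t)) - ten S (v(s := g t0)) = ten S (v(s := g t - g t0))"
      using ten_upd_diff_scaleR[OF H g g, of t 1 t0] by simp
    then have "ten S (v(s := g t)) - ten S (v(s := g t0)) - (t - t0) *\<^sub>R ten S (v(s := g'))
        = ten S (v(s := g t - g t0 - (t - t0) *\<^sub>R g'))"
      using ten_upd_diff_scaleR[OF H m(1) g'] by simp
    then show ?thesis using K[OF m(2)] by simp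
  qed
  have "((\<lambda>t. norm (g t - g t0 - (t - t0) *\<^sub>R g') / norm (t - t0)) \<longlongrightarrow> 0) (at t0)"
    using d by (simp add: has_vector_derivative_def has_derivative_iff_norm)
  from tendsto_mult_left_zero[OF this, of ?K] show ?thesis
    by (simp add: has_vector_derivative_def has_derivative_iff_norm eq bounded_linear_scaleR_left)
qed

section \<open>Point values of the separable operator\<close>

text \<open>Captures what the factors w_m^a and their partial derivatives have in common, so that
  one evaluation lemma treats both.\<close>

definition channel_regular :: "('h, 'g, 'v, 'l, 'z) setting_scheme \<Rightarrow> nat \<Rightarrow> 'h \<Rightarrow> bool" where
  "channel_regular S m w \<longleftrightarrow> w \<in> Hsp S m \<and>
     (\<forall>l\<in>set (Lam S m). \<exists>h. cont_rep (Imeas S m) (cIval S m) (Dop S m l w) h)"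

text \<open>The setting provides representatives for the channels only; continuity of the
  coefficients transfers them to \<open>Aop\<close>. This is applied in every coordinate, not just
  in the differentiated one.\<close>

lemma Aop_cont_rep:
  assumes ch: "channels_ok S" and m: "m < ddim S" and \<beta>: "\<beta> < RA S" and w: "channel_regular S m w"
  obtains h where "cont_rep (Imeas S m) (cIval S m) (Aop S m \<beta> w) h"
    and "\<And>x. x \<in> Ival S m \<Longrightarrow>
      h x = (\<Sum>l\<in>set (Lam S m). bco S m l \<beta> x * Ieval S m (Dop S m l w) x)"
proof -
  obtain k where k: "\<And>l. l \<in> set (Lam S m) \<Longrightarrow> cont_rep (Imeas S m) (cIval S m) (Dop S m l w) (k l)"
    using w unfolding channel_regular_def by metis
  define h where "h = (\<lambda>x. \<Sum>l\<in>set (Lam S m). bco S m l \<beta> x * k l x)"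
  have "continuous_on (cIval S m) h"
    unfolding h_def using k ch m \<beta>
    by (intro continuous_intros) (auto simp: cont_rep_def channels_ok_def)
  moreover have "AE x in Imeas S m. h x = Aop S m \<beta> w x"
  proof -
    have "AE x in Imeas S m. \<forall>l\<in>set (Lam S m). k l x = Dop S m l w x"
      using k by (subst AE_finite_all) (auto simp: cont_rep_def)
    moreover have "AE x in Imeas S m.
        Aop S m \<beta> w x = (\<Sum>l\<in>set (Lam S m). bco S m l \<beta> x * Dop S m l w x)"
      using ch m \<beta> w unfolding channels_ok_def channel_regular_def by blast
    ultimately show ?thesis
      by eventually_elim (simp add: h_def)
  qed
  ultimately have "cont_rep (Imeas S m) (cIval S m) (Aop S m \<beta> w) h"
    by (simp add: cont_rep_def)
  moreover have "h x = (\<Sum>l\<in>set (Lam S m). bco S m l \<beta> x * Ieval S m (Dop S m l w) x)"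
    if "x \<in> Ival S m" for x
    unfolding h_def using Ieval_eq[OF k that] by (intro sum.cong) auto
  ultimately show thesis by (rule that)
qed

lemma Ieval_Aop:
  assumes "channels_ok S" "m < ddim S" "\<beta> < RA S" "channel_regular S m w" "x \<in> Ival S m"
  shows "Ieval S m (Aop S m \<beta> w) x
    = (\<Sum>l\<in>set (Lam S m). bco S m l \<beta> x * Ieval S m (Dop S m l w) x)"
proof -
  obtain h where h: "cont_rep (Imeas S m) (cIval S m) (Aop S m \<beta> w) h"
    "\<And>x. x \<in> Ival S m \<Longrightarrow>
      h x = (\<Sum>l\<in>set (Lam S m). bco S m l \<beta> x * Ieval S m (Dop S m l w) x)"
    using Aop_cont_rep[OF assms(1-4)] by blast
  show ?thesis
    using Ieval_eq[OF h(1) assms(5)] h(2)[OF assms(5)] by simp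
qed

text \<open>Each use of additivity or homogeneity costs a null set depending on the vectors; a
  finite sum costs finitely many.\<close>

lemma linear_ae_sum:
  assumes T: "linear_ae UNIV M T" and "finite I"
  shows "AE x in M. T (\<Sum>i\<in>I. c i *\<^sub>R v i) x = (\<Sum>i\<in>I. c i *\<^sub>R T (v i) x)"
proof -
  have add: "AE x in M. T (v + w) x = T v x + T w x"
    and scale: "AE x in M. T (r *\<^sub>R v) x = r *\<^sub>R T v x" for v w r
    using T by (auto simp: linear_ae_def)
  show ?thesis
    using assms(2)
  proof (induction I)
    case empty
    \<comment> \<open>Homogeneity with r = 0 shows that \<open>T 0\<close> vanishes almost
      everywhere.\<close>
    show ?case using scale[of 0 0] by simp
  next
    case (insert i I)
    from insert.IH add[of "c i *\<^sub>R v i" "\<Sum>i\<in>I. c i *\<^sub>R v i"] scale[of "c i" "v i"]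
    show ?case by eventually_elim (simp add: insert.hyps)
  qed
qed

text \<open>The decomposition of \<open>opA\<close> holds only almost everywhere. Hence an explicit
  continuous function \<open>h\<close> is assembled from univariate representatives and shown to
  represent the image; its value at \<open>z\<close> is then the point value.\<close>

lemma Deval_opA:
  fixes v :: "'i \<Rightarrow> nat \<Rightarrow> 'h::{real_inner, complete_space}"
  assumes op: "operator_ok S" and ch: "channels_ok S" and I: "finite I"
    and v: "\<And>i m. i \<in> I \<Longrightarrow> m < ddim S \<Longrightarrow> channel_regular S m (v i m)"
    and z: "z \<in> PiE {..<ddim S} (Ival S)"
  shows "Deval S (opA S (Uemb S (\<Sum>i\<in>I. c i *\<^sub>R ten S (v i)))) z =
    (\<Sum>\<beta><RA S. \<Sum>i\<in>I. c i * (\<Prod>m<ddim S. Ieval S m (Aop S m \<beta> (v i m)) (z m)))"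
proof -
  let ?R = "\<lambda>m \<beta> w. cont_rep (Imeas S m) (cIval S m) (Aop S m \<beta> w)"
  obtain T where T: "\<And>\<beta>. \<beta> < RA S \<Longrightarrow> is_tensor_op S (\<lambda>m. Aop S m \<beta>) (T \<beta>)"
    and AT: "\<And>g. AE z in Dmeas S. opA S (Uemb S g) z = (\<Sum>\<beta><RA S. T \<beta> g z)"
    using op unfolding operator_ok_def by blast
  \<comment> \<open>Fixing one representative per triple makes \<open>h\<close> a single explicit
    function; the choice is genuine for the triples that occur.\<close>
  define k where "k m \<beta> w = (SOME h. ?R m \<beta> w h)" for m \<beta> w
  have k: "?R m \<beta> (v i m) (k m \<beta> (v i m))" if "i \<in> I" "m < ddim S" "\<beta> < RA S" for i m \<beta>
    unfolding k_def using Aop_cont_rep[OF ch that(2,3) v[OF that(1,2)]] by (metis someI_ex)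
  define h where "h = (\<lambda>z. \<Sum>\<beta><RA S. \<Sum>i\<in>I. c i * (\<Prod>m<ddim S. k m \<beta> (v i m) (z m)))"
  have "continuous_on (Dclosure S) (\<lambda>z. k m \<beta> (v i m) (z m))"
    if "i \<in> I" "m < ddim S" "\<beta> < RA S" for i m \<beta>
  proof (rule continuous_on_compose2[where g = "k m \<beta> (v i m)"])
    show "continuous_on (cIval S m) (k m \<beta> (v i m))"
      using k[OF that] by (simp add: cont_rep_def)
    show "(\<lambda>z. z m) ` Dclosure S \<subseteq> cIval S m"
      using that(2) by (auto simp: Dclosure_def PiE_def Pi_def)
  qed (rule continuous_on_subset[OF continuous_on_product_coordinates subset_UNIV])
  then have cont: "continuous_on (Dclosure S) h"
    unfolding h_def by (intro continuous_on_sum continuous_on_mult continuous_on_const continuous_on_prod) auto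
  have "AE z in Dmeas S. k m \<beta> (v i m) (z m) = Aop S m \<beta> (v i m) (z m)"
    if "i \<in> I" "m < ddim S" "\<beta> < RA S" for i m \<beta>
    using k[OF that] that(2) by (intro AE_Dmeas_component) (simp_all add: cont_rep_def)
  \<comment> \<open>All index sets are finite, so the exceptional sets unite to one null
    set.\<close>
  then have "AE z in Dmeas S. \<forall>\<beta>\<in>{..<RA S}. \<forall>i\<in>I. \<forall>m\<in>{..<ddim S}.
      k m \<beta> (v i m) (z m) = Aop S m \<beta> (v i m) (z m)"
    using I by (simp add: AE_finite_all)
  moreover have "AE z in Dmeas S. \<forall>\<beta>\<in>{..<RA S}. \<forall>i\<in>I.
      T \<beta> (ten S (v i)) z = (\<Prod>m<ddim S. Aop S m \<beta> (v i m) (z m))"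
    using T v I by (simp add: AE_finite_all is_tensor_op_def Htuples_def channel_regular_def)
  moreover have "AE z in Dmeas S.
      T \<beta> (\<Sum>i\<in>I. c i *\<^sub>R ten S (v i)) z = (\<Sum>i\<in>I. c i *\<^sub>R T \<beta> (ten S (v i)) z)"
    if "\<beta> < RA S" for \<beta>
    using T[OF that] I by (intro linear_ae_sum) (simp_all add: is_tensor_op_def bounded_linear_L2_def)
  then have "AE z in Dmeas S. \<forall>\<beta>\<in>{..<RA S}.
      T \<beta> (\<Sum>i\<in>I. c i *\<^sub>R ten S (v i)) z = (\<Sum>i\<in>I. c i *\<^sub>R T \<beta> (ten S (v i)) z)"
    by (subst AE_finite_all) auto
  moreover note AT[of "\<Sum>i\<in>I. c i *\<^sub>R ten S (v i)"]
  ultimately have "AE z in Dmeas S. h z = opA S (Uemb S (\<Sum>i\<in>I. c i *\<^sub>R ten S (v i))) z"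
    by eventually_elim (simp add: h_def)
  with cont have "cont_rep (Dmeas S) (Dclosure S) (opA S (Uemb S (\<Sum>i\<in>I. c i *\<^sub>R ten S (v i)))) h"
    by (simp add: cont_rep_def)
  from Deval_eq[OF this z]
  have "Deval S (opA S (Uemb S (\<Sum>i\<in>I. c i *\<^sub>R ten S (v i)))) z = h z" .
  \<comment> \<open>The coordinates of \<open>z\<close> are interior, so the chosen representatives
    take the point values there.\<close>
  also have "\<dots> = (\<Sum>\<beta><RA S. \<Sum>i\<in>I. c i * (\<Prod>m<ddim S. Ieval S m (Aop S m \<beta> (v i m)) (z m)))"
    unfolding h_def
  proof (intro sum.cong refl arg_cong2[where f = "(*)"] prod.cong)
    fix \<beta> i m assume "\<beta> \<in> {..<RA S}" "i \<in> I" "m \<in> {..<ddim S}"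
    moreover from this have "z m \<in> Ival S m" using z by (auto simp: PiE_def Pi_def)
    ultimately show "k m \<beta> (v i m) (z m) = Ieval S m (Aop S m \<beta> (v i m)) (z m)"
      using Ieval_eq[OF k] by simp
  qed
  finally show ?thesis .
qed


section \<open>Entries of the Jacobian\<close>

text \<open>Makes \<open>channel_regular\<close> available for the differentiated factor.\<close>

lemma partial_net_in_Hsp:
  assumes "H_ok S" "architecture_ok S" "s < ddim S" "a < kdim S s"
    "\<tau> \<in> carrier_vec (pdim S s)" "j < pdim S s"
  shows "partial (pdim S s) (net S s a) \<tau> j \<in> Hsp S s"
proof (rule has_vector_derivative_in_closed_subspace)
  show "((\<lambda>t. net S s a (\<tau> + t \<cdot>\<^sub>v unit_vec (pdim S s) j)) has_vector_derivative
      partial (pdim S s) (net S s a) \<tau> j) (at 0)"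
    using assms by (intro has_vector_derivative_partial) (auto simp: architecture_ok_def)
  show "net S s a (\<tau> + t \<cdot>\<^sub>v unit_vec (pdim S s) j) \<in> Hsp S s" for t
    using assms by (auto simp: architecture_ok_def)
qed (use assms in \<open>auto simp: H_ok_def\<close>)

lemma partial_uhat:
  assumes H: "H_ok S" and ar: "architecture_ok S" and \<theta>: "\<theta> \<in> params S"
    and s: "s < ddim S" and j: "j < pdim S s"
  shows "partial (pdim S s) (\<lambda>\<tau>. uhat S (\<theta>(s := \<tau>))) (\<theta> s) j =
    (\<Sum>as\<in>idx_set (klist S). carr S as *\<^sub>R ten S ((\<lambda>m. net S m (as ! m) (\<theta> m))
      (s := partial (pdim S s) (net S s (as ! s)) (\<theta> s) j)))"
proof -
  let ?p = "\<lambda>t. \<theta> s + t \<cdot>\<^sub>v unit_vec (pdim S s) j"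
  have \<theta>s: "\<theta> m \<in> carrier_vec (pdim S m)" if "m < ddim S" for m
    using \<theta> that by (simp add: params_def)
  have "((\<lambda>t. carr S as *\<^sub>R ten S (\<lambda>m. net S m (as ! m) ((\<theta>(s := ?p t)) m))) has_vector_derivative
      carr S as *\<^sub>R ten S ((\<lambda>m. net S m (as ! m) (\<theta> m))
        (s := partial (pdim S s) (net S s (as ! s)) (\<theta> s) j))) (at 0)"
    if as: "as \<in> idx_set (klist S)" for as
  proof -
    have k: "as ! m < kdim S m" if "m < ddim S" for m
      using idx_set_nth_less[OF as, of m] that by (simp add: klist_def)
    have "((\<lambda>t. ten S ((\<lambda>m. net S m (as ! m) (\<theta> m))(s := net S s (as ! s) (?p t))))
        has_vector_derivative ten S ((\<lambda>m. net S m (as ! m) (\<theta> m))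
        (s := partial (pdim S s) (net S s (as ! s)) (\<theta> s) j))) (at 0)"
    proof (rule ten_has_vector_derivative[OF H _ s])
      show "(\<lambda>m. net S m (as ! m) (\<theta> m)) \<in> Htuples S"
        using ar k \<theta>s by (auto simp: Htuples_def architecture_ok_def)
      show "net S s (as ! s) (?p t) \<in> Hsp S s" for t
        using ar k[OF s] s \<theta>s[OF s] by (auto simp: architecture_ok_def)
      show "((\<lambda>t. net S s (as ! s) (?p t)) has_vector_derivative
          partial (pdim S s) (net S s (as ! s)) (\<theta> s) j) (at 0)"
        using ar k[OF s] s \<theta>s[OF s] j
        by (intro has_vector_derivative_partial) (auto simp: architecture_ok_def)
    qed
    \<comment> \<open>Perturbing the block \<theta> s is the same as updating factor s, since no
      other factor depends on it.\<close>
    moreover have "(\<lambda>m. net S m (as ! m) (\<theta> m))(s := net S s (as ! s) (?p t))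
        = (\<lambda>m. net S m (as ! m) ((\<theta>(s := ?p t)) m))" for t
      by auto
    ultimately show ?thesis
      using bounded_linear.has_vector_derivative[OF bounded_linear_scaleR_right] by fastforce
  qed
  then have "((\<lambda>t. uhat S (\<theta>(s := ?p t))) has_vector_derivative
    (\<Sum>as\<in>idx_set (klist S). carr S as *\<^sub>R ten S ((\<lambda>m. net S m (as ! m) (\<theta> m))
      (s := partial (pdim S s) (net S s (as ! s)) (\<theta> s) j)))) (at 0)"
    unfolding uhat_def by (rule has_vector_derivative_sum)
  then show ?thesis unfolding partial_def by (rule vector_derivative_at)
qed

text \<open>Only the differentiated factor is expanded into channels; the other factors stay in the
  form in which \<open>Emat\<close> contains them.\<close>

lemma Jac_entry:
  assumes S: "separable_setting S" and \<theta>: "\<theta> \<in> params S"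
    and s: "s < ddim S" and i: "i < ND S" and j: "j < pdim S s"
  defines "z \<equiv> \<lambda>m. zcol S m (multi_idx (nlist S) i ! m)"
  shows "index_mat (Jac S \<theta> s) (i, j) =
    (\<Sum>\<beta><RA S. \<Sum>as\<in>idx_set (klist S). carr S as *
      ((\<Sum>l\<in>set (Lam S s). bco S s l \<beta> (z s) *
          Ieval S s (Dop S s l (partial (pdim S s) (net S s (as ! s)) (\<theta> s) j)) (z s)) *
       (\<Prod>m\<in>{..<ddim S} - {s}. Ieval S m (Aop S m \<beta> (net S m (as ! m) (\<theta> m))) (z m))))"
proof -
  have H: "H_ok S" and op: "operator_ok S" and ch: "channels_ok S" and ar: "architecture_ok S"
    and co: "collocation_ok S"
    using S by (auto simp: separable_setting_def)
  have \<theta>s: "\<theta> m \<in> carrier_vec (pdim S m)" if "m < ddim S" for m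
    using \<theta> that by (simp add: params_def)
  let ?d = "\<lambda>a. partial (pdim S s) (net S s a) (\<theta> s) j"
  let ?v = "\<lambda>as. (\<lambda>m. net S m (as ! m) (\<theta> m))(s := ?d (as ! s))"
  have k: "as ! m < kdim S m" if "as \<in> idx_set (klist S)" "m < ddim S" for as m
    using idx_set_nth_less[OF that(1), of m] that(2) by (simp add: klist_def)
  have ix: "multi_idx (nlist S) i \<in> idx_set (nlist S)"
    using i by (intro multi_idx_in_idx_set) (simp add: ND_def nlist_def prod.list_conv_set_nth atLeast0LessThan)
  have z: "z m \<in> Ival S m" if "m < ddim S" for m
    using idx_set_nth_less[OF ix, of m] co that by (auto simp: z_def nlist_def collocation_ok_def)
  then have g: "grid_pt S i \<in> PiE {..<ddim S} (Ival S)"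
    by (auto simp: grid_pt_def z_def)
  have gm: "grid_pt S i m = z m" if "m < ddim S" for m
    using that by (simp add: grid_pt_def z_def)
  have regd: "channel_regular S s (?d a)" if "a < kdim S s" for a
    using partial_net_in_Hsp[OF H ar s that \<theta>s[OF s] j] co s that \<theta>s[OF s] j
    unfolding channel_regular_def collocation_ok_def by blast
  have reg: "channel_regular S m (?v as m)" if "as \<in> idx_set (klist S)" "m < ddim S" for as m
  proof (cases "m = s")
    case True
    then show ?thesis using regd k[OF that(1) s] by simp
  next
    case False
    then show ?thesis using ar co k[OF that] \<theta>s[OF that(2)] that(2)
      by (auto simp: channel_regular_def architecture_ok_def collocation_ok_def)
  qed
  have "index_mat (Jac S \<theta> s) (i, j) =
      Deval S (opA S (Uemb S (\<Sum>as\<in>idx_set (klist S). carr S as *\<^sub>R ten S (?v as)))) (grid_pt S i)"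
    using i j by (simp add: Jac_def partial_uhat[OF H ar \<theta> s j])
  also have "\<dots> = (\<Sum>\<beta><RA S. \<Sum>as\<in>idx_set (klist S). carr S as *
      (\<Prod>m<ddim S. Ieval S m (Aop S m \<beta> (?v as m)) (grid_pt S i m)))"
    by (rule Deval_opA[OF op ch finite_idx_set reg g])
  also have "\<dots> = (\<Sum>\<beta><RA S. \<Sum>as\<in>idx_set (klist S). carr S as *
      ((\<Sum>l\<in>set (Lam S s). bco S s l \<beta> (z s) * Ieval S s (Dop S s l (?d (as ! s))) (z s)) *
       (\<Prod>m\<in>{..<ddim S} - {s}. Ieval S m (Aop S m \<beta> (net S m (as ! m) (\<theta> m))) (z m))))"
  proof (intro sum.cong refl arg_cong2[where f = "(*)"])
    fix \<beta> as assume "\<beta> \<in> {..<RA S}" and as: "as \<in> idx_set (klist S)"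
    then have \<beta>: "\<beta> < RA S" by simp
    have "(\<Prod>m<ddim S. Ieval S m (Aop S m \<beta> (?v as m)) (grid_pt S i m)) =
        Ieval S s (Aop S s \<beta> (?v as s)) (grid_pt S i s) *
        (\<Prod>m\<in>{..<ddim S} - {s}. Ieval S m (Aop S m \<beta> (?v as m)) (grid_pt S i m))"
      using s by (intro prod.remove) auto
    also have "Ieval S s (Aop S s \<beta> (?v as s)) (grid_pt S i s) =
        (\<Sum>l\<in>set (Lam S s). bco S s l \<beta> (z s) * Ieval S s (Dop S s l (?d (as ! s))) (z s))"
      using Ieval_Aop[OF ch s \<beta> regd[OF k[OF as s]] z[OF s]] gm[OF s] by simp
    also have "(\<Prod>m\<in>{..<ddim S} - {s}. Ieval S m (Aop S m \<beta> (?v as m)) (grid_pt S i m)) =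
        (\<Prod>m\<in>{..<ddim S} - {s}. Ieval S m (Aop S m \<beta> (net S m (as ! m) (\<theta> m))) (z m))"
      using gm by (intro prod.cong) auto
    finally show "(\<Prod>m<ddim S. Ieval S m (Aop S m \<beta> (?v as m)) (grid_pt S i m)) =
        (\<Sum>l\<in>set (Lam S s). bco S s l \<beta> (z s) * Ieval S s (Dop S s l (?d (as ! s))) (z s)) *
        (\<Prod>m\<in>{..<ddim S} - {s}. Ieval S m (Aop S m \<beta> (net S m (as ! m) (\<theta> m))) (z m))" .
  qed
  finally show ?thesis .
qed


section \<open>The channel factorization\<close>

lemma ND_eq: "ND S = prod_list (nlist S)"
  by (simp add: ND_def nlist_def prod.list_conv_set_nth atLeast0LessThan)

lemma Jac_carrier: "Jac S \<theta> s \<in> carrier_mat (ND S) (pdim S s)"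
  by (simp add: Jac_def)

lemma Psi_chan_carrier: "Psi_chan S \<theta> s l \<in> carrier_mat (ND S) (ncol S s * kdim S s)"
  by (simp add: Psi_chan_def)

lemma Hmat_carrier: "Hmat S \<theta> s l \<in> carrier_mat (ncol S s * kdim S s) (pdim S s)"
  by (simp add: Hmat_def)

lemma Nch_eq: "Nch S s = (\<Sum>l\<leftarrow>Lam S s. ncol S s * kdim S s)"
  by (simp add: Nch_def sum_list_triv)

lemma Psi_blk_carrier: "Psi_blk S \<theta> s \<in> carrier_mat (ND S) (Nch S s)"
  unfolding Psi_blk_def Nch_eq by (intro hcat_carrier Psi_chan_carrier)

lemma C_blk_carrier: "C_blk S \<theta> s \<in> carrier_mat (Nch S s) (pdim S s)"
  unfolding C_blk_def Nch_eq by (intro vcat_carrier Hmat_carrier)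

text \<open>The row position encodes the reduced multi-index and \<open>Emat\<close> decodes it;
  \<open>multi_idx\<close> inverts \<open>lex_pos\<close>, so the entries of \<open>is\<close>
  reappear.\<close>

lemma Emat_entry:
  assumes s: "s < ddim S" and ix: "is \<in> idx_set (nlist S)" and a: "a < kdim S s"
  shows "index_mat (Emat S \<theta> s \<beta>) (lex_pos (remove_nth s (nlist S)) (remove_nth s is), a) =
    (\<Sum>as\<in>{as \<in> idx_set (klist S). as ! s = a}. carr S as *
       (\<Prod>m\<in>{..<ddim S} - {s}. Ieval S m (Aop S m \<beta> (net S m (as ! m) (\<theta> m)))
          (zcol S m (is ! m))))"
proof -
  have r: "remove_nth s is \<in> idx_set (remove_nth s (nlist S))"
    using ix by (rule remove_nth_in_idx_set)
  \<comment> \<open>Entries are determined only inside the matrix, so the position must be below the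
    row count.\<close>
  have lp: "lex_pos (remove_nth s (nlist S)) (remove_nth s is) < (\<Prod>m\<in>{..<ddim S} - {s}. ncol S m)"
    using lex_pos_less[OF r] by (simp add: nlist_def prod_list_remove_nth[OF s])
  have rm: "remove_nth s is ! (if m < s then m else m - 1) = is ! m"
    if "m \<in> {..<ddim S} - {s}" for m
    using that s length_idx_set[OF ix] by (intro remove_nth_nth) (auto simp: nlist_def)
  have "index_mat (Emat S \<theta> s \<beta>) (lex_pos (remove_nth s (nlist S)) (remove_nth s is), a) =
      (\<Sum>as\<in>{as \<in> idx_set (klist S). as ! s = a}. carr S as *
        (\<Prod>m\<in>{..<ddim S} - {s}. Ieval S m (Aop S m \<beta> (net S m (as ! m) (\<theta> m)))
          (zcol S m (remove_nth s is ! (if m < s then m else m - 1)))))"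
    using a lp by (simp add: Emat_def multi_idx_lex_pos[OF r])
  also have "\<dots> = (\<Sum>as\<in>{as \<in> idx_set (klist S). as ! s = a}. carr S as *
       (\<Prod>m\<in>{..<ddim S} - {s}. Ieval S m (Aop S m \<beta> (net S m (as ! m) (\<theta> m)))
          (zcol S m (is ! m))))"
    by (intro sum.cong refl arg_cong2[where f = "(*)"] prod.cong) (simp only: rm)
  finally show ?thesis .
qed

text \<open>Among the pairs (js, a) of the inner index, the Kronecker delta keeps those with js =
  i_s, leaving a sum over a.\<close>

lemma Psi_chan_mult_Hmat:
  assumes s: "s < ddim S" and i: "i < ND S" and j: "j < pdim S s"
  defines "is \<equiv> multi_idx (nlist S) i"
  shows "index_mat (Psi_chan S \<theta> s l * Hmat S \<theta> s l) (i, j) =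
    (\<Sum>a<kdim S s. (\<Sum>\<beta><RA S. bco S s l \<beta> (zcol S s (is ! s)) *
        index_mat (Emat S \<theta> s \<beta>) (lex_pos (remove_nth s (nlist S)) (remove_nth s is), a)) *
      Ieval S s (Dop S s l (partial (pdim S s) (net S s a) (\<theta> s) j)) (zcol S s (is ! s)))"
proof -
  have "is \<in> idx_set (nlist S)"
    unfolding is_def using i by (intro multi_idx_in_idx_set) (simp add: ND_eq)
  then have iss: "is ! s < ncol S s"
    using idx_set_nth_less[of "is" "nlist S" s] s by (simp add: nlist_def)
  let ?X = "\<lambda>js a. \<Sum>\<beta><RA S. bco S s l \<beta> (zcol S s js) *
        index_mat (Emat S \<theta> s \<beta>) (lex_pos (remove_nth s (nlist S)) (remove_nth s is), a)"
  let ?Y = "\<lambda>js a. Ieval S s (Dop S s l (partial (pdim S s) (net S s a) (\<theta> s) j)) (zcol S s js)"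
  have "index_mat (Psi_chan S \<theta> s l * Hmat S \<theta> s l) (i, j) =
      (\<Sum>q<ncol S s * kdim S s.
        index_mat (Psi_chan S \<theta> s l) (i, q) * index_mat (Hmat S \<theta> s l) (q, j))"
    using i j carrier_matD[OF Psi_chan_carrier[of S \<theta> s l]] carrier_matD[OF Hmat_carrier[of S \<theta> s l]]
    by (simp add: scalar_prod_def atLeast0LessThan)
  \<comment> \<open>The summand is written as a function of quotient and remainder, the shape
    \<open>sum_div_mod\<close> expects.\<close>
  also have "\<dots> = (\<Sum>q<ncol S s * kdim S s. (\<lambda>js a. (if is ! s = js then ?X js a * ?Y js a else 0))
      (q div kdim S s) (q mod kdim S s))"
    using i j by (intro sum.cong) (auto simp: Psi_chan_def Hmat_def is_def Let_def)
  also have "\<dots> = (\<Sum>js<ncol S s. \<Sum>a<kdim S s. if is ! s = js then ?X js a * ?Y js a else 0)"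
    by (rule sum_div_mod)
  also have "\<dots> = (\<Sum>js<ncol S s. if is ! s = js then \<Sum>a<kdim S s. ?X js a * ?Y js a else 0)"
    by (intro sum.cong) auto
  also have "\<dots> = (\<Sum>a<kdim S s. ?X (is ! s) a * ?Y (is ! s) a)"
    using iss by simp
  finally show ?thesis .
qed

text \<open>Grouping the multi-indices by their s-th entry a separates the derivative channels,
  which depend on a alone, from the sum over the remaining indices, which is an entry of
  \<open>Emat\<close>.\<close>

lemma Jac_eq:
  assumes S: "separable_setting S" and \<theta>: "\<theta> \<in> params S" and s: "s < ddim S"
  shows "Jac S \<theta> s = Psi_blk S \<theta> s * C_blk S \<theta> s"
proof (rule eq_matI)
  fix i j assume "i < dim_row (Psi_blk S \<theta> s * C_blk S \<theta> s)" "j < dim_col (Psi_blk S \<theta> s * C_blk S \<theta> s)"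
  then have i: "i < ND S" and j: "j < pdim S s"
    using carrier_matD[OF Psi_blk_carrier[of S \<theta> s]] carrier_matD[OF C_blk_carrier[of S \<theta> s]] by auto
  let ?is = "multi_idx (nlist S) i"
  let ?z = "\<lambda>m. zcol S m (?is ! m)"
  let ?D = "\<lambda>l a. Ieval S s (Dop S s l (partial (pdim S s) (net S s a) (\<theta> s) j)) (?z s)"
  let ?b = "\<lambda>l \<beta>. bco S s l \<beta> (?z s)"
  let ?G = "\<lambda>\<beta> as. carr S as *
      (\<Prod>m\<in>{..<ddim S} - {s}. Ieval S m (Aop S m \<beta> (net S m (as ! m) (\<theta> m))) (?z m))"
  let ?E = "\<lambda>\<beta> a. \<Sum>as\<in>{as \<in> idx_set (klist S). as ! s = a}. ?G \<beta> as"
  have ix: "?is \<in> idx_set (nlist S)"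
    using i by (intro multi_idx_in_idx_set) (simp add: ND_eq)
  have "distinct (Lam S s)"
    using S s by (simp add: separable_setting_def channels_ok_def)
  have "index_mat (Psi_blk S \<theta> s * C_blk S \<theta> s) (i, j) =
      (\<Sum>l\<leftarrow>Lam S s. index_mat (Psi_chan S \<theta> s l * Hmat S \<theta> s l) (i, j))"
    unfolding Psi_blk_def C_blk_def using i j
    by (intro hcat_mult_vcat[where k = "\<lambda>_. ncol S s * kdim S s"] Psi_chan_carrier Hmat_carrier)
  \<comment> \<open>Distinctness matters: a repeated channel would count twice in the list but once
    in the set.\<close>
  also have "\<dots> = (\<Sum>l\<in>set (Lam S s). index_mat (Psi_chan S \<theta> s l * Hmat S \<theta> s l) (i, j))"
    using \<open>distinct (Lam S s)\<close> by (rule sum.distinct_set_conv_list[symmetric])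
  also have "\<dots> = (\<Sum>l\<in>set (Lam S s). \<Sum>a<kdim S s. \<Sum>\<beta><RA S. ?b l \<beta> * ?E \<beta> a * ?D l a)"
    using i j s by (intro sum.cong) (simp_all add: Psi_chan_mult_Hmat Emat_entry[OF s ix] sum_distrib_right)
  also have "\<dots> = (\<Sum>a<kdim S s. \<Sum>\<beta><RA S. \<Sum>l\<in>set (Lam S s). ?b l \<beta> * ?E \<beta> a * ?D l a)"
    by (subst sum.swap) (intro sum.cong refl sum.swap)
  also have "\<dots> = (\<Sum>\<beta><RA S. \<Sum>a<kdim S s. \<Sum>l\<in>set (Lam S s). ?b l \<beta> * ?E \<beta> a * ?D l a)"
    by (rule sum.swap)
  also have "\<dots> = (\<Sum>\<beta><RA S. \<Sum>as\<in>idx_set (klist S). (\<Sum>l\<in>set (Lam S s). ?b l \<beta> * ?D l (as ! s)) * ?G \<beta> as)"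
  proof (rule sum.cong[OF refl])
    fix \<beta>
    \<comment> \<open>Each group collects the multi-indices with a common s-th entry, which is below
      \<open>kdim S s\<close>.\<close>
    have "(\<Sum>as\<in>idx_set (klist S). (\<Sum>l\<in>set (Lam S s). ?b l \<beta> * ?D l (as ! s)) * ?G \<beta> as) =
        (\<Sum>a<kdim S s. \<Sum>as\<in>{as \<in> idx_set (klist S). as ! s = a}.
          (\<Sum>l\<in>set (Lam S s). ?b l \<beta> * ?D l (as ! s)) * ?G \<beta> as)"
      using s idx_set_nth_less[of _ "klist S" s]
      by (intro sum.group[symmetric] finite_idx_set) (auto simp: klist_def)
    also have "\<dots> = (\<Sum>a<kdim S s. (\<Sum>l\<in>set (Lam S s). ?b l \<beta> * ?D l a) * ?E \<beta> a)"
      by (intro sum.cong refl) (simp add: sum_distrib_left)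
    also have "\<dots> = (\<Sum>a<kdim S s. \<Sum>l\<in>set (Lam S s). ?b l \<beta> * ?E \<beta> a * ?D l a)"
      by (intro sum.cong refl, subst sum_distrib_right, intro sum.cong refl) (simp only: mult_ac)
    finally show "(\<Sum>a<kdim S s. \<Sum>l\<in>set (Lam S s). ?b l \<beta> * ?E \<beta> a * ?D l a) =
        (\<Sum>as\<in>idx_set (klist S). (\<Sum>l\<in>set (Lam S s). ?b l \<beta> * ?D l (as ! s)) * ?G \<beta> as)" ..
  qed
  also have "\<dots> = index_mat (Jac S \<theta> s) (i, j)"
    unfolding Jac_entry[OF S \<theta> s i j] by (intro sum.cong refl) (simp add: mult_ac)
  finally show "index_mat (Jac S \<theta> s) (i, j) = index_mat (Psi_blk S \<theta> s * C_blk S \<theta> s) (i, j)" ..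
qed (use carrier_matD[OF Jac_carrier[of S \<theta> s]] carrier_matD[OF Psi_blk_carrier[of S \<theta> s]]
    carrier_matD[OF C_blk_carrier[of S \<theta> s]] in auto)

section \<open>Assembly of the full factorization, Gramian and gradient\<close>

lemma sum_list_upt_eq_sum: "(\<Sum>x\<leftarrow>[0..<n]. f x) = (\<Sum>x<n. f x)"
  by (simp add: interv_sum_list_conv_sum_set_nat atLeast0LessThan)

lemma Jfull_carrier: "Jfull S \<theta> \<in> carrier_mat (ND S) (Ptot S)"
  using hcat_carrier[of "[0..<ddim S]" "Jac S \<theta>" "ND S" "pdim S", OF Jac_carrier]
  by (simp add: Jfull_def Ptot_def sum_list_upt_eq_sum)

lemma Psi_carrier: "Psi S \<theta> \<in> carrier_mat (ND S) (Neff S)"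
  using hcat_carrier[of "[0..<ddim S]" "Psi_blk S \<theta>" "ND S" "Nch S", OF Psi_blk_carrier]
  by (simp add: Psi_def Neff_def sum_list_upt_eq_sum)

lemma Cmat_carrier: "Cmat S \<theta> \<in> carrier_mat (Neff S) (Ptot S)"
  using diag_block_mat_carrier[of "[0..<ddim S]" "C_blk S \<theta>" "Nch S" "pdim S", OF C_blk_carrier]
  by (simp add: Cmat_def Neff_def Ptot_def sum_list_upt_eq_sum)

lemma Jfull_eq:
  assumes "separable_setting S" "\<theta> \<in> params S"
  shows "Jfull S \<theta> = Psi S \<theta> * Cmat S \<theta>"
proof -
  have "Psi S \<theta> * Cmat S \<theta> = hcat (ND S) (map (\<lambda>s. Psi_blk S \<theta> s * C_blk S \<theta> s) [0..<ddim S])"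
    unfolding Psi_def Cmat_def
    by (rule hcat_mult_diag_block_mat[OF Psi_blk_carrier C_blk_carrier])
  also have "\<dots> = Jfull S \<theta>"
    unfolding Jfull_def using Jac_eq[OF assms]
    by (intro arg_cong[where f = "hcat (ND S)"] map_cong) auto
  finally show ?thesis ..
qed

text \<open>Two independent factorizations cover the blocks with s different from t; the full
  Gramian is the case A = C, B = D.\<close>

lemma gram_mult:
  fixes A B C D :: "'a::comm_ring mat"
  assumes A: "A \<in> carrier_mat n k" and B: "B \<in> carrier_mat k p"
    and C: "C \<in> carrier_mat n m" and D: "D \<in> carrier_mat m q"
  shows "c \<cdot>\<^sub>m (transpose_mat (A * B) * (C * D))
    = transpose_mat B * (c \<cdot>\<^sub>m (transpose_mat A * C)) * D"
proof -
  have t: "transpose_mat A \<in> carrier_mat k n" "transpose_mat B \<in> carrier_mat p k"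
    using A B by auto
  have AC: "transpose_mat A * C \<in> carrier_mat k m"
    using t C by auto
  have "transpose_mat (A * B) * (C * D) = transpose_mat B * transpose_mat A * (C * D)"
    using A B by (simp add: transpose_mult)
  also have "\<dots> = transpose_mat B * (transpose_mat A * (C * D))"
    using t C D by (intro assoc_mult_mat) auto
  also have "transpose_mat A * (C * D) = transpose_mat A * C * D"
    using t C D by (intro assoc_mult_mat[symmetric]) auto
  also have "transpose_mat B * (transpose_mat A * C * D) = transpose_mat B * (transpose_mat A * C) * D"
    using t AC D by (intro assoc_mult_mat[symmetric]) auto
  finally have "transpose_mat (A * B) * (C * D) = transpose_mat B * (transpose_mat A * C) * D" .
  then show ?thesis
    using t AC D mult_smult_distrib[OF t(2) AC] mult_smult_assoc_mat[of _ p m D q]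
    by simp
qed

lemma transpose_mult_mult_vec:
  fixes A B :: "'a::field mat"
  assumes A: "A \<in> carrier_mat n k" and B: "B \<in> carrier_mat k p" and v: "v \<in> carrier_vec n"
  shows "c \<cdot>\<^sub>v (transpose_mat (A * B) *\<^sub>v v) = transpose_mat B *\<^sub>v (c \<cdot>\<^sub>v (transpose_mat A *\<^sub>v v))"
proof -
  have t: "transpose_mat A \<in> carrier_mat k n" "transpose_mat B \<in> carrier_mat p k"
    using A B by auto
  have "transpose_mat (A * B) *\<^sub>v v = transpose_mat B *\<^sub>v (transpose_mat A *\<^sub>v v)"
    using A B t v by (simp add: transpose_mult)
  moreover have "transpose_mat A *\<^sub>v v \<in> carrier_vec k"
    using t v by simp
  ultimately show ?thesis
    using mult_mat_vec[OF t(2)] by simp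
qed

theorem theorem2p12:
  fixes S :: "('h::{real_inner, complete_space}, 'g::{real_inner, complete_space},
               'v::{real_inner, complete_space, second_countable_topology}, 'l) setting"
    and \<theta> :: "nat \<Rightarrow> real Matrix.vec"
  assumes "separable_setting S" and "\<theta> \<in> params S"
  shows
    "((\<forall>s<ddim S. Jac S \<theta> s \<in> carrier_mat (ND S) (pdim S s) \<and>
          Psi_blk S \<theta> s \<in> carrier_mat (ND S) (Nch S s) \<and>
          C_blk S \<theta> s \<in> carrier_mat (Nch S s) (pdim S s) \<and>
          Jac S \<theta> s = Psi_blk S \<theta> s * C_blk S \<theta> s) \<and>
      Neff S = (\<Sum>s<ddim S. length (Lam S s) * ncol S s * kdim S s) \<and>
      Jfull S \<theta> \<in> carrier_mat (ND S) (Ptot S) \<and>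
      Psi S \<theta> \<in> carrier_mat (ND S) (Neff S) \<and>
      Cmat S \<theta> \<in> carrier_mat (Neff S) (Ptot S) \<and>
      Jfull S \<theta> = Psi S \<theta> * Cmat S \<theta>)
     \<and>
     (Ups S \<theta> = vcat (Neff S) (map (\<lambda>s. hcat (Nch S s)
          (map (\<lambda>t. Ups_blk S \<theta> s t) [0..<ddim S])) [0..<ddim S]) \<and>
      (\<forall>s<ddim S. \<forall>t<ddim S.
          Ups_blk S \<theta> s t = vcat (Nch S t) (map (\<lambda>l. hcat (ncol S s * kdim S s)
            (map (\<lambda>l'. Ups_chan S \<theta> s t l l') (Lam S t))) (Lam S s))) \<and>
      Gram S \<theta> = vcat (Ptot S) (map (\<lambda>s. hcat (pdim S s)
          (map (\<lambda>t. Gram_block S \<theta> s t) [0..<ddim S])) [0..<ddim S]) \<and>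
      Gram S \<theta> = transpose_mat (Cmat S \<theta>) * Ups S \<theta> * Cmat S \<theta> \<and>
      (\<forall>s<ddim S. \<forall>t<ddim S.
          Gram_block S \<theta> s t = transpose_mat (C_blk S \<theta> s) * Ups_blk S \<theta> s t * C_blk S \<theta> t) \<and>
      mat_rank (Gram S \<theta>) = mat_rank (Jfull S \<theta>) \<and>
      mat_rank (Jfull S \<theta>) \<le> Min {ND S, Neff S, Ptot S})
     \<and>
     (rho_c S \<theta> = vstack (map (rho_c_blk S \<theta>) [0..<ddim S]) \<and>
      (\<forall>s<ddim S. rho_c_blk S \<theta> s = vstack (map (rho_c_chan S \<theta> s) (Lam S s))) \<and>
      grad S \<theta> = transpose_mat (Cmat S \<theta>) *\<^sub>v rho_c S \<theta> \<and>
      (\<forall>s<ddim S. grad_block S \<theta> s = transpose_mat (C_blk S \<theta> s) *\<^sub>v rho_c_blk S \<theta> s))"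
proof -
  note J = Jac_eq[OF assms] and JF = Jfull_eq[OF assms]
  have r: "resid S \<theta> \<in> carrier_vec (ND S)" by (simp add: resid_def)
  \<comment> \<open>Every n_m is positive, so the scalar 1 / N_D is nonzero, as
    \<open>rank_gram\<close> requires.\<close>
  have ND: "ND S \<noteq> 0"
    using assms(1) by (auto simp: separable_setting_def collocation_ok_def ND_def)
  \<comment> \<open>\<open>Neff S\<close> is rewritten as a list sum, the form in which
    \<open>gram_hcat\<close> gives the width.\<close>
  have U: "Ups S \<theta> = vcat (Neff S) (map (\<lambda>s. hcat (Nch S s)
      (map (\<lambda>t. Ups_blk S \<theta> s t) [0..<ddim S])) [0..<ddim S])"
    unfolding Ups_def Psi_def Neff_def sum_list_upt_eq_sum[symmetric] Ups_blk_def
    by (rule gram_hcat[OF Psi_blk_carrier Psi_blk_carrier])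
  have Ub: "Ups_blk S \<theta> s t = vcat (Nch S t) (map (\<lambda>l. hcat (ncol S s * kdim S s)
      (map (\<lambda>l'. Ups_chan S \<theta> s t l l') (Lam S t))) (Lam S s))" for s t
    unfolding Ups_blk_def Psi_blk_def Nch_eq Ups_chan_def
    by (rule gram_hcat[OF Psi_chan_carrier Psi_chan_carrier])
  have G: "Gram S \<theta> = vcat (Ptot S) (map (\<lambda>s. hcat (pdim S s)
      (map (\<lambda>t. Gram_block S \<theta> s t) [0..<ddim S])) [0..<ddim S])"
    unfolding Gram_def Jfull_def Ptot_def sum_list_upt_eq_sum[symmetric] Gram_block_def
    by (rule gram_hcat[OF Jac_carrier Jac_carrier])
  have GC: "Gram S \<theta> = transpose_mat (Cmat S \<theta>) * Ups S \<theta> * Cmat S \<theta>"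
    unfolding Gram_def JF Ups_def
    by (rule gram_mult[OF Psi_carrier Cmat_carrier Psi_carrier Cmat_carrier])
  have Gb: "Gram_block S \<theta> s t = transpose_mat (C_blk S \<theta> s) * Ups_blk S \<theta> s t * C_blk S \<theta> t"
    if "s < ddim S" "t < ddim S" for s t
    unfolding Gram_block_def J[OF that(1)] J[OF that(2)] Ups_blk_def
    by (rule gram_mult[OF Psi_blk_carrier C_blk_carrier Psi_blk_carrier C_blk_carrier])
  have rG: "mat_rank (Gram S \<theta>) = mat_rank (Jfull S \<theta>)"
    unfolding Gram_def using ND by (intro rank_gram[OF Jfull_carrier]) simp
  have rJ: "mat_rank (Jfull S \<theta>) \<le> Min {ND S, Neff S, Ptot S}"
    unfolding JF by (rule rank_le_min[OF Psi_carrier Cmat_carrier])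
  have R: "rho_c S \<theta> = vstack (map (rho_c_blk S \<theta>) [0..<ddim S])"
    unfolding rho_c_def Psi_def rho_c_blk_def
    by (rule transpose_hcat_mult_vec[OF Psi_blk_carrier r])
  have Rb: "rho_c_blk S \<theta> s = vstack (map (rho_c_chan S \<theta> s) (Lam S s))" for s
    unfolding rho_c_blk_def Psi_blk_def rho_c_chan_def
    by (rule transpose_hcat_mult_vec[OF Psi_chan_carrier r])
  have g: "grad S \<theta> = transpose_mat (Cmat S \<theta>) *\<^sub>v rho_c S \<theta>"
    unfolding grad_def JF rho_c_def
    by (rule transpose_mult_mult_vec[OF Psi_carrier Cmat_carrier r])
  have gb: "grad_block S \<theta> s = transpose_mat (C_blk S \<theta> s) *\<^sub>v rho_c_blk S \<theta> s"
    if "s < ddim S" for s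
    unfolding grad_block_def J[OF that] rho_c_blk_def
    by (rule transpose_mult_mult_vec[OF Psi_blk_carrier C_blk_carrier r])
  have N: "Neff S = (\<Sum>s<ddim S. length (Lam S s) * ncol S s * kdim S s)"
    by (simp add: Neff_def Nch_def)
  show ?thesis
    by (intro conjI allI impI Jac_carrier Psi_blk_carrier C_blk_carrier J N Jfull_carrier
        Psi_carrier Cmat_carrier JF U Ub G GC Gb rG rJ R Rb g gb)
qed

end
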